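(* Let $f_0:(0,1)\to\mathbb{R}$, $V_0:\mathbb{R}^{|\mathcal{K}|}\to\mathbb{R}$, $f_k:(0,1)\times[0,1]\to\mathbb{R}\cup\{+\infty\}$ and let $V_k^*$ be a scalar for each $k\in\mathbb{K}$. Consider the problem $$(\mathrm{UB})\qquad \min_{z,\rho,(y_k)_{k\in\mathbb{K}}} z\quad\text{s.t.}\quad \rho^T\mu_{\tilde c}+f_0(p_0)V_0(\rho)\le z,\quad \rho^T\mu_{\tilde d^k}+f_k(p_1,y_k)V_k^*\le \xi_k\ \ \forall k\in\mathbb{K},$$ $$\sum_{k\in\mathbb{K}}y_k=1,\quad y_k\ge 0\ \ \forall k\in\mathbb{K},\quad \rho\in\mathcal{Q}^\alpha(\gamma).$$ In each of the following three cases, (UB) is a convex programming problem and its optimal value is an upper bound to the optimal value of the individual chance-constrained problem (ICCP) defined in the context. 1. Suppose the mean vectors $\mu_{\tilde c},\mu_{\tilde d^k}$ and covariance matrices $\Sigma_{\tilde c},\Sigma_{\tilde d^k}$ of $\tilde c,\tilde d^k$, $k\in\mathbb{K}$, are known (in particular exist), and take $f_0(p_0)=\sqrt{\frac{p_0}{1-p_0}}$, $V_0(\rho)=\|\Sigma_{\tilde c}^{1/2}\rho\|_2$, $f_k(p_1,y_k)=\sqrt{\frac{p_1^{y_k^{1/\theta}}}{1-p_1^{y_k^{1/\theta}}}}$, $V_k^*=\max_{\bar\rho\in\mathcal{Q}^\alpha(\gamma)}\sum_{(s,a)\in\mathcal{K}}\bar\rho(s,a)\,\big\|(\Sigma_{\tilde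 d^k}^{1/2})_{(s,a)}\big\|_2$, where $(\Sigma_{\tilde d^k}^{1/2})_{(s,a)}$ is the $(s,a)$-th column of $\Sigma_{\tilde d^k}^{1/2}$. 2. Suppose the mean vectors $\mu_{\tilde c},\mu_{\tilde d^k}$ and upper and lower bound vectors $\tilde c^u,\tilde c^l$ of $\tilde c$ and $\tilde d^{ku},\tilde d^{kl}$ of $\tilde d^k$, $k\in\mathbb{K}$, are known, that the components of $\tilde c$ are independent and, for each $k$, the components of $\tilde d^k$ are independent, and that $p_1\ge 1-e^{-1/2}$. Take $f_0(p_0)=\sqrt{-\frac12\ln(1-p_0)}$, $V_0(\rho)=\|D_{\tilde c}^{1/2}\rho\|_2$, $f_k(p_1,y_k)=\sqrt{-\frac12\ln\big(1-p_1^{y_k^{1/\theta}}\big)}$, $V_k^*=\max_{\bar\rho\in\mathcal{Q}^\alpha(\gamma)}\sum_{(s,a)\in\mathcal{K}}\bar\rho(s,a)\big(\tilde d^{ku}(s,a)-\tilde d^{kl}(s,a)\big)$, where $D_{\tilde c}$ is the $|\mathcal{K}|\times|\mathcal{K}|$ diagonal matrix with $(s,a)$-th diagonal entry $(\tilde c^u(s,a)-\tilde c^l(s,a))^2$. 3. Suppose the components of $\tilde c$ are independent and, for each $k$, the components of $\tilde d^k$ are independent; that for each $(s,a)\in\mathcal{K}$, $\tilde c(s,a)$ and $\tilde d^k(s,a)$ are sub-Gaussian random variables with means $\mu_{\tilde c}(s,a)$, $\mu_{\tilde d^k}(s,a)$ and sub-Gaussian parameters $\sigma_{\tilde c}(s,a)$,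 $\sigma_{\tilde d^k}(s,a)$, respectively; and that $p_1\ge 1-e^{-1/2}$. Take $f_0(p_0)=\sqrt{-2\ln(1-p_0)}$, $V_0(\rho)=\|\Sigma_{\tilde c,SG}^{1/2}\rho\|_2$, $f_k(p_1,y_k)=\sqrt{-2\ln\big(1-p_1^{y_k^{1/\theta}}\big)}$, $V_k^*=\max_{\bar\rho\in\mathcal{Q}^\alpha(\gamma)}\sum_{(s,a)\in\mathcal{K}}\bar\rho(s,a)\sigma_{\tilde d^k}(s,a)$, where $\Sigma_{\tilde c,SG}$ is the $|\mathcal{K}|\times|\mathcal{K}|$ diagonal matrix with $(s,a)$-th diagonal entry $\sigma_{\tilde c}^2(s,a)$.
   Context: $S$ is a finite nonempty state space, $A(s)$ a finite nonempty action set for each $s\in S$, $\mathcal{K}=\{(s,a): s\in S,\ a\in A(s)\}$, $\alpha\in(0,1)$ a discount factor, $\gamma$ a probability distribution on $S$, $p(s'|s,a)$ known transition probabilities, and $\delta$ the Kronecker delta. Define $$\mathcal{Q}^\alpha(\gamma)=\Big\{\rho\in\mathbb{R}^{|\mathcal{K}|}:\ \sum_{(s,a)\in\mathcal{K}}\rho(s,a)\big(\delta(s',s)-\alpha p(s'|s,a)\big)=(1-\alpha)\gamma(s')\ \forall s'\in S,\ \ \rho(s,a)\ge 0\ \forall (s,a)\in\mathcal{K}\Big\}.$$ Let $\mathbb{K}=\{1,\dots,K\}$, $\xi_k\in\mathbb{R}$, $p_0,p_1\in(0,1)$, $\theta\ge1$. The running cost vectors $\tilde c=(\tilde c(s,a))_{(s,a)\in\mathcal{K}}$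 and $\tilde d^k=(\tilde d^k(s,a))_{(s,a)\in\mathcal{K}}$, $k\in\mathbb{K}$, are random vectors on a probability space $(\Omega,\mathcal{F},\mathbb{P})$. The individual chance-constrained problem is $$(\mathrm{ICCP})\quad \min_{z,\rho,(y_k)_{k\in\mathbb{K}}} z\ \ \text{s.t.}\ \ \mathbb{P}(\rho^T\tilde c\le z)\ge p_0,\quad \mathbb{P}(\rho^T\tilde d^k\le\xi_k)\ge p_1^{y_k^{1/\theta}}\ \forall k\in\mathbb{K},\quad \rho\in\mathcal{Q}^\alpha(\gamma),\ \sum_{k\in\mathbb{K}}y_k=1,\ y_k\ge0\ \forall k\in\mathbb{K}.$$ Conventions: the optimal value of a minimization problem is the infimum of its objective over its feasible set ($+\infty$ if infeasible). "Upper/lower bound vectors" $\tilde c^u,\tilde c^l$ means $\tilde c^l(s,a)\le\tilde c(s,a)\le\tilde c^u(s,a)$ for all $(s,a)$ and all realizations; similarly for $\tilde d^{ku},\tilde d^{kl}$. A random variable $X$ with mean $\mu$ is sub-Gaussian with parameter $\sigma\ge0$ if $\mathbb{E}e^{t(X-\mu)}\le e^{\sigma^2t^2/2}$ for all $t\in\mathbb{R}$. $\Sigma^{1/2}$ is the symmetric positive semidefinite square root. At $y_k=0$ the expressions for $f_k(p_1,y_k)$ take the value $+\infty$, with $0\cdot(+\infty)=0$. "Convex programming problem" means a linear objective, with all constraints being linear or of the form $g\le0$ with $g$ a convex (extended-valued) function of the variables. *)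

theory Defs
  imports "HOL-Probability.Probability"
begin

datatype 'v constr =
    Eq "'v \<Rightarrow> real" real
  | Le "'v \<Rightarrow> ereal" real

fun satisfies :: "'v \<Rightarrow> 'v constr \<Rightarrow> bool" where
  "satisfies x (Eq h b) \<longleftrightarrow> h x = b"
| "satisfies x (Le g b) \<longleftrightarrow> g x \<le> ereal b"

definition feasible :: "'v constr set \<Rightarrow> 'v set" where
  "feasible C = {x. \<forall>c\<in>C. satisfies x c}"

text \<open>The infimum over the empty set is \<open>\<infinity>\<close> here, since it is taken in the extended reals.\<close>

definition opt_value :: "('v \<Rightarrow> real) \<Rightarrow> 'v set \<Rightarrow> ereal" where
  "opt_value obj F = (INF x\<in>F. ereal (obj x))"

text \<open>Convexity of a function with values in \<open>\<real> \<union> {+\<infinity>}\<close>. In the extended reals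
  \<open>0 * \<infinity> = 0\<close>, so the endpoints \<open>u = 0\<close>, \<open>v = 0\<close> are harmless.\<close>

definition convex_ext :: "('v::real_vector \<Rightarrow> ereal) \<Rightarrow> bool" where
  "convex_ext g \<longleftrightarrow> (\<forall>x. g x \<noteq> -\<infinity>) \<and>
     (\<forall>x y u v. 0 \<le> u \<and> 0 \<le> v \<and> u + v = 1 \<longrightarrow>
        g (u *\<^sub>R x + v *\<^sub>R y) \<le> ereal u * g x + ereal v * g y)"

text \<open>Linear inequality constraints are the special case of a linear, hence convex, \<open>g\<close>.\<close>

fun convex_constr :: "'v::real_vector constr \<Rightarrow> bool" where
  "convex_constr (Eq h b) \<longleftrightarrow> linear h"
| "convex_constr (Le g b) \<longleftrightarrow> convex_ext g"

definition convex_program :: "('v::real_vector \<Rightarrow> real) \<Rightarrow> 'v constr set \<Rightarrow> bool" where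
  "convex_program obj C \<longleftrightarrow> linear obj \<and> finite C \<and> (\<forall>c\<in>C. convex_constr c)"

definition psd :: "real^'k^'k \<Rightarrow> bool" where
  "psd R \<longleftrightarrow> transpose R = R \<and> (\<forall>x. 0 \<le> x \<bullet> (R *v x))"

text \<open>The square root exists and is unique whenever the argument is positive semidefinite.\<close>

definition psd_sqrt :: "real^'k^'k \<Rightarrow> real^'k^'k" where
  "psd_sqrt A = (SOME R. psd R \<and> R ** R = A)"

definition diag_mat :: "real^'k \<Rightarrow> real^'k^'k" where
  "diag_mat v = (\<chi> i j. if i = j then v $ i else 0)"

definition mean_vec :: "'w measure \<Rightarrow> ('w \<Rightarrow> real^'k) \<Rightarrow> real^'k" where
  "mean_vec M X = (\<chi> i. integral\<^sup>L M (\<lambda>w. X w $ i))"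

definition cov_mat :: "'w measure \<Rightarrow> ('w \<Rightarrow> real^'k) \<Rightarrow> real^'k^'k" where
  "cov_mat M X = (\<chi> i j. integral\<^sup>L M
     (\<lambda>w. (X w $ i - mean_vec M X $ i) * (X w $ j - mean_vec M X $ j)))"

definition has_mean_cov :: "'w measure \<Rightarrow> ('w \<Rightarrow> real^'k) \<Rightarrow> bool" where
  "has_mean_cov M X \<longleftrightarrow> (\<forall>i. integrable M (\<lambda>w. X w $ i)) \<and>
     (\<forall>i j. integrable M
        (\<lambda>w. (X w $ i - mean_vec M X $ i) * (X w $ j - mean_vec M X $ j)))"

definition indep_components :: "'w measure \<Rightarrow> ('w \<Rightarrow> real^'k) \<Rightarrow> bool" where
  "indep_components M X \<longleftrightarrow> prob_space.indep_vars M (\<lambda>_. borel) (\<lambda>i w. X w $ i) UNIV"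

definition bounded_by :: "'w measure \<Rightarrow> ('w \<Rightarrow> real^'k) \<Rightarrow> real^'k \<Rightarrow> real^'k \<Rightarrow> bool" where
  "bounded_by M X l u \<longleftrightarrow> (\<forall>w\<in>space M. \<forall>i. l $ i \<le> X w $ i \<and> X w $ i \<le> u $ i)"

text \<open>Integrability is part of the definition because the Bochner integral of a
  non-integrable function is 0.\<close>

definition sub_gaussian :: "'w measure \<Rightarrow> ('w \<Rightarrow> real) \<Rightarrow> real \<Rightarrow> bool" where
  "sub_gaussian M X \<sigma> \<longleftrightarrow> 0 \<le> \<sigma> \<and> integrable M X \<and>
     (\<forall>t. integrable M (\<lambda>w. exp (t * (X w - integral\<^sup>L M X))) \<and>
          integral\<^sup>L M (\<lambda>w. exp (t * (X w - integral\<^sup>L M X))) \<le> exp (\<sigma>\<^sup>2 * t\<^sup>2 / 2))"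

text \<open>The finite index type \<open>'k\<close> enumerates the state-action pairs: \<open>pr\<close> is a bijection
  from \<open>'k\<close> onto \<open>\<K> = (SIGMA s:S. A s)\<close>, so that \<open>real^'k\<close> is \<open>\<real>\<close> to the power \<open>|\<K>|\<close>.\<close>

definition mdp :: "'s set \<Rightarrow> ('s \<Rightarrow> 'a set) \<Rightarrow> ('k::finite \<Rightarrow> 's \<times> 'a) \<Rightarrow>
    ('s \<Rightarrow> 'a \<Rightarrow> 's pmf) \<Rightarrow> 's pmf \<Rightarrow> bool" where
  "mdp S A pr p \<gamma> \<longleftrightarrow>
     finite S \<and> S \<noteq> {} \<and> (\<forall>s\<in>S. finite (A s) \<and> A s \<noteq> {}) \<and>
     bij_betw pr UNIV (SIGMA s:S. A s) \<and>
     (\<forall>s\<in>S. \<forall>a\<in>A s. set_pmf (p s a) \<subseteq> S) \<and> set_pmf \<gamma> \<subseteq> S"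

definition balance :: "('k::finite \<Rightarrow> 's \<times> 'a) \<Rightarrow> real \<Rightarrow> ('s \<Rightarrow> 'a \<Rightarrow> 's pmf) \<Rightarrow>
    's \<Rightarrow> real^'k \<Rightarrow> real" where
  "balance pr \<alpha> p s' \<rho> =
     (\<Sum>i\<in>UNIV. case pr i of (s, a) \<Rightarrow>
        \<rho> $ i * ((if s' = s then 1 else 0) - \<alpha> * pmf (p s a) s'))"

definition occ :: "'s set \<Rightarrow> ('k::finite \<Rightarrow> 's \<times> 'a) \<Rightarrow> real \<Rightarrow> ('s \<Rightarrow> 'a \<Rightarrow> 's pmf) \<Rightarrow>
    's pmf \<Rightarrow> (real^'k) set" where
  "occ S pr \<alpha> p \<gamma> =
     {\<rho>. (\<forall>s'\<in>S. balance pr \<alpha> p s' \<rho> = (1 - \<alpha>) * pmf \<gamma> s') \<and> (\<forall>i. 0 \<le> \<rho> $ i)}"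

text \<open>The decision variables of both problems are \<open>(z, \<rho>, y)\<close>, with objective \<open>z\<close>;
  the finite index type \<open>'m\<close> plays the role of \<open>{1..K}\<close>.\<close>

type_synonym ('k, 'm) var = "real \<times> (real^'k) \<times> (real^'m)"

text \<open>The probability level \<open>p\<close> to the power \<open>y\<^bsup>1/\<theta>\<^esup>\<close>; at \<open>y = 0\<close> it equals 1.\<close>

definition level :: "real \<Rightarrow> real \<Rightarrow> real \<Rightarrow> real" where
  "level \<theta> p y = p powr (y powr (1 / \<theta>))"

definition ICCP_feasible :: "'w measure \<Rightarrow> ('w \<Rightarrow> real^'k) \<Rightarrow> ('m \<Rightarrow> 'w \<Rightarrow> real^'k) \<Rightarrow>
    ('m \<Rightarrow> real) \<Rightarrow> real \<Rightarrow> real \<Rightarrow> real \<Rightarrow> (real^'k) set \<Rightarrow> ('k, 'm::finite) var set" where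
  "ICCP_feasible M c d \<xi> p0 p1 \<theta> Q =
     {(z, \<rho>, y).
        \<P>(w in M. \<rho> \<bullet> c w \<le> z) \<ge> p0 \<and>
        (\<forall>k. \<P>(w in M. \<rho> \<bullet> d k w \<le> \<xi> k) \<ge> level \<theta> p1 (y $ k)) \<and>
        \<rho> \<in> Q \<and> (\<Sum>k\<in>UNIV. y $ k) = 1 \<and> (\<forall>k. 0 \<le> y $ k)}"

definition UB_constrs :: "'s set \<Rightarrow> ('k::finite \<Rightarrow> 's \<times> 'a) \<Rightarrow> real \<Rightarrow> ('s \<Rightarrow> 'a \<Rightarrow> 's pmf) \<Rightarrow>
    's pmf \<Rightarrow> real^'k \<Rightarrow> ('m \<Rightarrow> real^'k) \<Rightarrow> ('m \<Rightarrow> real) \<Rightarrow> real \<Rightarrow> real \<Rightarrow>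
    (real \<Rightarrow> real) \<Rightarrow> (real^'k \<Rightarrow> real) \<Rightarrow> ('m \<Rightarrow> real \<Rightarrow> real \<Rightarrow> ereal) \<Rightarrow> ('m \<Rightarrow> real) \<Rightarrow>
    ('k, 'm::finite) var constr set" where
  "UB_constrs S pr \<alpha> p \<gamma> \<mu>c \<mu>d \<xi> p0 p1 f0 V0 f Vs =
     {Le (\<lambda>(z, \<rho>, y). ereal (\<rho> \<bullet> \<mu>c + f0 p0 * V0 \<rho> - z)) 0} \<union>
     range (\<lambda>k. Le (\<lambda>(z, \<rho>, y). ereal (\<rho> \<bullet> \<mu>d k) + f k p1 (y $ k) * ereal (Vs k)) (\<xi> k)) \<union>
     {Eq (\<lambda>(z, \<rho>, y). \<Sum>k\<in>UNIV. y $ k) 1} \<union>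
     range (\<lambda>k. Le (\<lambda>(z, \<rho>, y). ereal (- (y $ k))) 0) \<union>
     (\<lambda>s'. Eq (\<lambda>(z, \<rho>, y). balance pr \<alpha> p s' \<rho>) ((1 - \<alpha>) * pmf \<gamma> s')) ` S \<union>
     range (\<lambda>i. Le (\<lambda>(z, \<rho>, y). ereal (- (\<rho> $ i))) 0)"

lemma feasible_UB_constrs:
  "feasible (UB_constrs S pr \<alpha> p \<gamma> \<mu>c \<mu>d \<xi> p0 p1 f0 V0 f Vs) =
     {(z, \<rho>, y).
        \<rho> \<bullet> \<mu>c + f0 p0 * V0 \<rho> \<le> z \<and>
        (\<forall>k. ereal (\<rho> \<bullet> \<mu>d k) + f k p1 (y $ k) * ereal (Vs k) \<le> ereal (\<xi> k)) \<and>
        (\<Sum>k\<in>UNIV. y $ k) = 1 \<and> (\<forall>k. 0 \<le> y $ k) \<and> \<rho> \<in> occ S pr \<alpha> p \<gamma>}"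
  unfolding feasible_def UB_constrs_def occ_def by (auto simp: ball_Un zero_ereal_def)

definition UB_valid :: "'w measure \<Rightarrow> ('w \<Rightarrow> real^'k) \<Rightarrow> ('m \<Rightarrow> 'w \<Rightarrow> real^'k) \<Rightarrow>
    's set \<Rightarrow> ('k::finite \<Rightarrow> 's \<times> 'a) \<Rightarrow> real \<Rightarrow> ('s \<Rightarrow> 'a \<Rightarrow> 's pmf) \<Rightarrow> 's pmf \<Rightarrow>
    ('m::finite \<Rightarrow> real) \<Rightarrow> real \<Rightarrow> real \<Rightarrow> real \<Rightarrow>
    (real \<Rightarrow> real) \<Rightarrow> (real^'k \<Rightarrow> real) \<Rightarrow> ('m \<Rightarrow> real \<Rightarrow> real \<Rightarrow> ereal) \<Rightarrow> ('m \<Rightarrow> real) \<Rightarrow> bool" where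
  "UB_valid M c d S pr \<alpha> p \<gamma> \<xi> p0 p1 \<theta> f0 V0 f Vs \<longleftrightarrow>
     (let UB = UB_constrs S pr \<alpha> p \<gamma> (mean_vec M c) (\<lambda>k. mean_vec M (d k)) \<xi> p0 p1 f0 V0 f Vs in
        convex_program fst UB \<and>
        opt_value fst (ICCP_feasible M c d \<xi> p0 p1 \<theta> (occ S pr \<alpha> p \<gamma>)) \<le> opt_value fst (feasible UB))"

text \<open>The three choices of \<open>f\<^sub>k\<close>. They are real on \<open>(0, 1]\<close> and \<open>+\<infinity>\<close> at \<open>0\<close>; outside their
  domain \<open>[0, 1]\<close> they are extended by \<open>+\<infinity>\<close>, as usual for extended-valued convex
  functions. Feasible points always have \<open>y\<^sub>k \<in> [0, 1]\<close>.\<close>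

definition ext01 :: "(real \<Rightarrow> real) \<Rightarrow> real \<Rightarrow> ereal" where
  "ext01 h y = (if 0 < y \<and> y \<le> 1 then ereal (h y) else \<infinity>)"

definition f_cov :: "real \<Rightarrow> real \<Rightarrow> real \<Rightarrow> ereal" where
  "f_cov \<theta> p = ext01 (\<lambda>y. sqrt (level \<theta> p y / (1 - level \<theta> p y)))"

definition f_hoeffding :: "real \<Rightarrow> real \<Rightarrow> real \<Rightarrow> ereal" where
  "f_hoeffding \<theta> p = ext01 (\<lambda>y. sqrt (- (1/2) * ln (1 - level \<theta> p y)))"

definition f_sub_gaussian :: "real \<Rightarrow> real \<Rightarrow> real \<Rightarrow> ereal" where
  "f_sub_gaussian \<theta> p = ext01 (\<lambda>y. sqrt (- 2 * ln (1 - level \<theta> p y)))"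

text \<open>The maximum of \<open>\<rho> \<bullet> v\<close> over a set \<open>Q\<close>; it is attained for the nonempty compact set
  \<open>Q\<close> of occupation measures.\<close>

definition max_over :: "(real^'k) set \<Rightarrow> real^'k \<Rightarrow> real" where
  "max_over Q v = (SUP \<rho>\<in>Q. \<Sum>i\<in>UNIV. \<rho> $ i * v $ i)"

end

theory Submission
  imports Defs
begin

text \<open>
  Every feasible point of the upper-bound program is feasible for the chance-constrained one,
  so that the infimum over the former is at least the infimum over the latter; and the program is
  convex because the risk factors are convex in \<open>y\<close> and their weights are nonnegative.

  For feasibility, the three cases differ only in the tail inequality. Each provides a
  function \<open>q\<close> on \<open>(0, 1)\<close> and a dispersion \<open>s(\<rho>)\<close> such that \<open>\<rho> \<bullet> X\<close> is at most
  \<open>\<rho> \<bullet> \<mu> + q(t) s(\<rho>)\<close> with probability at least \<open>t\<close> (\<open>quantile_bound\<close>): the one-sided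
  Chebyshev (Cantelli) inequality with \<open>s(\<rho>)\<close> the standard deviation, and the Chernoff bound for
  sub-Gaussian variables. Bounded variables are sub-Gaussian with half the range as parameter
  (Hoeffding's lemma), so the second case is an instance of the third. By the triangle inequality
  \<open>s(\<rho>)\<close> is at most \<open>\<Sum>i. \<rho>\<^sub>i v\<^sub>i\<close> on nonnegative \<open>\<rho>\<close>, hence at most its maximum over
  the occupation measures. When \<open>y\<^sub>k = 0\<close> the probability level is 1 and \<open>f\<^sub>k = \<infinity>\<close>, so that
  feasibility forces the maximum, and with it the dispersion, to vanish; then the quantile bound
  holds with margin 0 for every \<open>t < 1\<close>, hence also at level 1.

  For convexity, write the level \<open>p\<close> to the power \<open>y\<^bsup>1/\<theta>\<^esup>\<close> as \<open>exp (- t)\<close> with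
  \<open>t = - ln p * y\<^bsup>1/\<theta>\<^esup>\<close>. Since \<open>\<theta> \<ge> 1\<close>, \<open>t\<close> is a concave function of \<open>y\<close>, and
  \<open>q (exp (- t))\<close> is decreasing and convex in \<open>t\<close>; this yields convexity in \<open>y\<close>.
  Multiplying by the maximum preserves convexity only if that maximum is nonnegative. It is,
  because the set of occupation measures is nonempty (a stationary policy has one) and bounded
  (the total mass is 1), while the \<open>v\<^sub>i\<close> are nonnegative.
\<close>

section \<open>Square roots of positive semidefinite matrices\<close>

text \<open>
  A maximizer \<open>v\<close> of the quadratic form on the unit sphere of \<open>V\<close> is an eigenvector: with
  \<open>l\<close> the maximum, \<open>l I - f\<close> is positive semidefinite on \<open>V\<close> and its quadratic form vanishes
  at \<open>v\<close>, which forces \<open>l v - f v = 0\<close>.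
\<close>

lemma symmetric_eigenvector_exists:
  fixes f :: "'a::euclidean_space \<Rightarrow> 'a"
  assumes lin: "linear f" and sym: "\<And>x y. f x \<bullet> y = x \<bullet> f y"
    and V: "subspace V" and inv: "f ` V \<subseteq> V" and ne: "V \<noteq> {0}"
  obtains v where "v \<in> V" "norm v = 1" "f v = (v \<bullet> f v) *\<^sub>R v"
proof -
  let ?K = "V \<inter> sphere 0 1"
  obtain x where x: "x \<in> V" "x \<noteq> 0" using ne subspace_0[OF V] by blast
  have "x /\<^sub>R norm x \<in> ?K" using x V by (simp add: subspace_scale)
  hence "?K \<noteq> {}" by blast
  moreover have "compact ?K" using closed_subspace[OF V] by (simp add: closed_Int_compact)
  moreover have "continuous_on ?K (\<lambda>x. x \<bullet> f x)"
    using lin by (intro continuous_intros linear_continuous_on) (simp add: linear_conv_bounded_linear)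
  ultimately obtain v where "v \<in> ?K" and "\<forall>w\<in>?K. w \<bullet> f w \<le> v \<bullet> f v"
    using continuous_attains_sup[of ?K "\<lambda>x. x \<bullet> f x"] by blast
  hence v: "v \<in> V" "norm v = 1"
    and max: "\<And>w. w \<in> V \<Longrightarrow> norm w = 1 \<Longrightarrow> w \<bullet> f w \<le> v \<bullet> f v"
    by auto
  define l where "l = v \<bullet> f v"
  define g where "g = (\<lambda>x. l *\<^sub>R x - f x)"
  have g_lin: "linear g"
    unfolding g_def by (intro linear_compose_sub linear_scale_self lin)
  have g_sym: "g x \<bullet> y = x \<bullet> g y" for x y
    by (simp add: g_def inner_diff sym)
  have g_pos: "0 \<le> w \<bullet> g w" if "w \<in> V" for w
  proof (cases "w = 0")
    case False
    have "(w /\<^sub>R norm w) \<bullet> f (w /\<^sub>R norm w) \<le> l"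
      unfolding l_def using that False V by (intro max) (auto simp: subspace_scale)
    hence "w \<bullet> f w \<le> l * (norm w)\<^sup>2"
      using False by (simp add: linear_scale[OF lin] field_simps power2_eq_square)
    thus ?thesis by (simp add: g_def inner_diff power2_norm_eq_inner)
  qed simp
  have vv: "v \<bullet> v = 1" using v(2) by (metis norm_eq_1)
  have gv0: "v \<bullet> g v = 0" by (simp add: g_def inner_diff l_def vv)
  have gvV: "g v \<in> V" using v inv V by (auto simp: g_def intro!: subspace_diff subspace_scale)
  have "0 \<le> 2 * t * (g v \<bullet> g v) + t\<^sup>2 * (g v \<bullet> g (g v))" for t
  proof -
    have "0 \<le> (v + t *\<^sub>R g v) \<bullet> g (v + t *\<^sub>R g v)"
      using v gvV V by (intro g_pos) (auto intro: subspace_add subspace_scale)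
    thus ?thesis
      by (simp add: linear_add[OF g_lin] linear_scale[OF g_lin] inner_add gv0 g_sym[of v "g v", symmetric]
          power2_eq_square algebra_simps)
  qed
  hence *: "0 \<le> 2 * t * a + t\<^sup>2 * b" if "a = g v \<bullet> g v" "b = g v \<bullet> g (g v)" for t a b :: real
    using that by simp
  have "g v \<bullet> g v = 0"
  proof (rule ccontr)
    define a b where ab: "a = g v \<bullet> g v" "b = g v \<bullet> g (g v)"
    assume "g v \<bullet> g v \<noteq> 0"
    hence a: "a > 0" by (simp add: ab)
    have b: "0 \<le> b" using g_pos[OF gvV] ab by simp
    \<comment> \<open>The quadratic form is nonnegative at \<open>v + t g(v)\<close> for every \<open>t\<close>. A small negative \<open>t\<close> makes
      the linear term dominate; \<open>t = - a c\<close> is small enough because \<open>b c < 2\<close>.\<close>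
    define c where "c = 1 / (b + 1)"
    have c: "0 < c" "b * c < 2" using b by (auto simp: c_def field_simps)
    have "0 \<le> 2 * (- (a * c)) * a + (- (a * c))\<^sup>2 * b" using * ab by blast
    also have "\<dots> = (a\<^sup>2 * c) * (b * c - 2)" by (simp add: power2_eq_square algebra_simps)
    also have "\<dots> < 0" using a c by (intro mult_pos_neg) auto
    finally show False by simp
  qed
  hence "f v = l *\<^sub>R v" by (simp add: g_def)
  thus thesis using that v l_def by blast
qed

text \<open>
  The orthogonal complement of an eigenvector is again invariant under a self-adjoint map, so the
  basis is split off one vector at a time.
\<close>

lemma symmetric_orthonormal_eigenbasis:
  fixes f :: "'a::euclidean_space \<Rightarrow> 'a"
  assumes lin: "linear f" and sym: "\<And>x y. f x \<bullet> y = x \<bullet> f y"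
    and V: "subspace V" and inv: "f ` V \<subseteq> V"
  obtains B where "finite B" "pairwise orthogonal B" "V \<subseteq> span B"
    "\<And>b. b \<in> B \<Longrightarrow> norm b = 1 \<and> f b = (b \<bullet> f b) *\<^sub>R b"
proof -
  have "\<exists>B. finite B \<and> pairwise orthogonal B \<and> B \<subseteq> V \<and> V \<subseteq> span B \<and>
          (\<forall>b\<in>B. norm b = 1 \<and> f b = (b \<bullet> f b) *\<^sub>R b)"
    using V inv
  proof (induction "dim V" arbitrary: V rule: less_induct)
    case less
    show ?case
    proof (cases "V = {0}")
      case True
      thus ?thesis by (intro exI[of _ "{}"]) auto
    next
      case False
      obtain v where v: "v \<in> V" "norm v = 1" and fv: "f v = (v \<bullet> f v) *\<^sub>R v"
        using symmetric_eigenvector_exists[OF lin sym less.prems False] by blast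
      have vv: "v \<bullet> v = 1" using v(2) by (metis norm_eq_1)
      define W where "W = V \<inter> {x. x \<bullet> v = 0}"
      have W: "subspace W" unfolding W_def
        using subspace_hyperplane[of v]
        by (intro subspace_inter less.prems) (simp add: inner_commute)
      have "v \<notin> W" by (simp add: W_def vv)
      moreover have "W \<subseteq> V" by (simp add: W_def)
      ultimately have "W \<subset> V" using v(1) by blast
      hence "dim W < dim V"
        using W less.prems(1) by (intro dim_psubset) (simp add: span_eq_iff[THEN iffD2])
      moreover have "f ` W \<subseteq> W"
      proof
        fix y assume "y \<in> f ` W"
        then obtain x where x: "x \<in> V" "x \<bullet> v = 0" "y = f x" by (auto simp: W_def)
        have "f x \<bullet> v = x \<bullet> ((v \<bullet> f v) *\<^sub>R v)" using sym fv by metis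
        thus "y \<in> W" using x less.prems(2) by (auto simp: W_def)
      qed
      ultimately obtain B where B: "finite B" "pairwise orthogonal B" "B \<subseteq> W" "W \<subseteq> span B"
          "\<forall>b\<in>B. norm b = 1 \<and> f b = (b \<bullet> f b) *\<^sub>R b"
        using less.hyps[OF _ W] by blast
      have "V \<subseteq> span (insert v B)"
      proof
        fix x assume x: "x \<in> V"
        have "x - (x \<bullet> v) *\<^sub>R v \<in> W"
          using x v less.prems(1) vv by (auto simp: W_def inner_diff intro!: subspace_diff subspace_scale)
        thus "x \<in> span (insert v B)" using B(4) by (auto simp: span_insert)
      qed
      moreover have "pairwise orthogonal (insert v B)"
        using B(2,3) by (auto simp: pairwise_insert orthogonal_def W_def inner_commute)
      ultimately show ?thesis
        using B v fv by (intro exI[of _ "insert v B"]) (auto simp: W_def)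
    qed
  qed
  thus thesis using that by blast
qed

text \<open>
  The square root keeps the eigenvectors and takes the square roots of the eigenvalues.
\<close>

lemma psd_square_root_exists:
  fixes A :: "real^'k^'k"
  assumes A: "psd A"
  obtains R where "psd R" "R ** R = A"
proof -
  have tA: "transpose A = A" and pA: "\<And>x. 0 \<le> x \<bullet> (A *v x)" using A by (auto simp: psd_def)
  have sym: "(A *v x) \<bullet> y = x \<bullet> (A *v y)" for x y
    by (metis dot_lmul_matrix tA transpose_matrix_vector)
  obtain B where B: "finite B" "pairwise orthogonal B" "UNIV \<subseteq> span B"
      and eig: "\<And>b. b \<in> B \<Longrightarrow> norm b = 1 \<and> A *v b = (b \<bullet> (A *v b)) *\<^sub>R b"
    using symmetric_orthonormal_eigenbasis[OF matrix_vector_mul_linear sym subspace_UNIV subset_UNIV]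
    by blast
  define r where "r = (\<lambda>b. sqrt (b \<bullet> (A *v b)))"
  define T where "T = (\<lambda>x. \<Sum>b\<in>B. (r b * (b \<bullet> x)) *\<^sub>R b)"
  have linT: "linear T" unfolding T_def
    by (intro linear_compose_sum ballI linearI) (auto simp: inner_add algebra_simps)
  have T_inner: "x \<bullet> T y = (\<Sum>b\<in>B. r b * (b \<bullet> x) * (b \<bullet> y))" for x y
    by (simp add: T_def inner_sum_right inner_commute algebra_simps)
  have Tb: "T b = r b *\<^sub>R b" if b: "b \<in> B" for b
  proof -
    have "c \<bullet> b = (if c = b then 1 else 0)" if "c \<in> B" for c
      using that b eig[OF b] B(2) by (auto simp: pairwise_def orthogonal_def norm_eq_1)
    hence "T b = (\<Sum>c\<in>B. if c = b then r b *\<^sub>R b else 0)"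
      unfolding T_def by (intro sum.cong) auto
    thus ?thesis using B(1) b by simp
  qed
  define R where "R = matrix T"
  have R: "R *v x = T x" for x by (simp add: R_def linT)
  have "A *v x = T (T x)" for x
  proof (rule linear_eq_on_span[where f = "(*v) A" and g = "T \<circ> T" and B = B, simplified])
    show "linear (T \<circ> T)" using linT by (simp add: linear_compose)
    show "x \<in> span B" using B by auto
    fix b assume b: "b \<in> B"
    have "T (T b) = (r b * r b) *\<^sub>R b" using b by (simp add: Tb linear_scale[OF linT])
    also have "r b * r b = b \<bullet> (A *v b)" by (simp add: r_def pA)
    finally show "A *v b = T (T b)" using eig[OF b] by simp
  qed
  hence "R ** R = A"
    by (simp add: matrix_eq R matrix_vector_mul_assoc[symmetric])
  moreover have "psd R"
    unfolding psd_def
  proof (intro conjI allI)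
    fix x show "0 \<le> x \<bullet> (R *v x)"
      by (simp add: R T_inner sum_nonneg r_def pA mult.assoc)
  next
    have "y \<bullet> (transpose R *v x) = y \<bullet> (R *v x)" for x y
      by (simp add: transpose_matrix_vector dot_lmul_matrix inner_commute[of y] R T_inner)
        (simp add: mult_ac)
    hence "transpose R *v x = R *v x" for x by (metis vector_eq_ldot)
    thus "transpose R = R" by (simp add: matrix_eq)
  qed
  ultimately show thesis using that by blast
qed

lemma
  assumes "psd A"
  shows psd_psd_sqrt: "psd (psd_sqrt A)" and psd_sqrt_square: "psd_sqrt A ** psd_sqrt A = A"
proof -
  have "\<exists>R. psd R \<and> R ** R = A" using psd_square_root_exists[OF assms] by blast
  from someI_ex[OF this] show "psd (psd_sqrt A)" "psd_sqrt A ** psd_sqrt A = A"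
    by (auto simp: psd_sqrt_def)
qed

text \<open>
  This turns the norm of the program into the quadratic form of the matrix, and thus refers to
  the square root only through its defining property.
\<close>

lemma norm_psd_sqrt_mult_squared:
  assumes "psd A"
  shows "(norm (psd_sqrt A *v x))\<^sup>2 = x \<bullet> (A *v x)"
proof -
  let ?R = "psd_sqrt A"
  have "transpose ?R = ?R" using psd_psd_sqrt[OF assms] by (simp add: psd_def)
  hence "(?R *v x) \<bullet> (?R *v x) = x \<bullet> (?R *v (?R *v x))"
    by (metis dot_lmul_matrix transpose_matrix_vector)
  thus ?thesis
    by (simp add: power2_norm_eq_inner matrix_vector_mul_assoc psd_sqrt_square[OF assms])
qed

lemma diag_mat_quadratic: "x \<bullet> (diag_mat v *v x) = (\<Sum>i\<in>UNIV. v $ i * (x $ i)\<^sup>2)"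
proof -
  have "(diag_mat v *v x) $ i = v $ i * x $ i" for i
    by (simp add: diag_mat_def matrix_vector_mult_def if_distrib[of "\<lambda>a. a * _"] cong: if_cong)
  thus ?thesis by (simp add: inner_vec_def power2_eq_square mult_ac)
qed

lemma norm_psd_sqrt_diag_mat:
  "norm (psd_sqrt (diag_mat (\<chi> i. (s $ i)\<^sup>2)) *v x) = L2_set (\<lambda>i. x $ i * s $ i) UNIV"
proof -
  have "psd (diag_mat (\<chi> i. (s $ i)\<^sup>2))"
    unfolding psd_def diag_mat_quadratic
    by (auto intro!: sum_nonneg simp: diag_mat_def transpose_def vec_eq_iff)
  from norm_psd_sqrt_mult_squared[OF this, of x]
  have "(norm (psd_sqrt (diag_mat (\<chi> i. (s $ i)\<^sup>2)) *v x))\<^sup>2 = (\<Sum>i\<in>UNIV. (x $ i * s $ i)\<^sup>2)"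
    by (simp add: diag_mat_quadratic power_mult_distrib mult.commute)
  thus ?thesis unfolding L2_set_def by (metis norm_ge_zero real_sqrt_unique)
qed

text \<open>
  The triangle inequality, for \<open>R *v x\<close> as a combination of the columns. It is the step from the
  norm in the deterministic counterpart to the linear function of \<open>\<rho>\<close> that is maximized.
\<close>

lemma norm_matrix_vector_mult_le_columns:
  fixes R :: "real^'n^'m"
  assumes "\<And>i. 0 \<le> x $ i"
  shows "norm (R *v x) \<le> (\<Sum>i\<in>UNIV. x $ i * norm (column i R))"
proof -
  have "norm (R *v x) = norm (\<Sum>i\<in>UNIV. x $ i *s column i R)"
    by (simp add: matrix_mult_sum)
  also have "\<dots> \<le> (\<Sum>i\<in>UNIV. norm (x $ i *s column i R))" by (rule norm_sum)
  also have "\<dots> = (\<Sum>i\<in>UNIV. x $ i * norm (column i R))"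
    using assms by (simp add: scalar_mult_eq_scaleR)
  finally show ?thesis .
qed

section \<open>Quantile bounds from tail inequalities\<close>

text \<open>
  The common form of the tail inequalities: \<open>m + q t * s\<close> bounds the \<open>t\<close>-quantile of \<open>X\<close>.
  The slack \<open>r\<close> is a separate variable so that the event can be matched with
  \<open>X \<le> b\<close> directly, by \<open>r = b - m\<close>.
\<close>

definition quantile_bound :: "'w measure \<Rightarrow> ('w \<Rightarrow> real) \<Rightarrow> real \<Rightarrow> (real \<Rightarrow> real) \<Rightarrow> real \<Rightarrow> bool" where
  "quantile_bound M X m q s \<longleftrightarrow>
     (\<forall>pr r. 0 < pr \<longrightarrow> pr < 1 \<longrightarrow> q pr * s \<le> r \<longrightarrow> pr \<le> \<P>(w in M. X w \<le> m + r))"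

context prob_space
begin

lemma prob_le_ge_if_prob_ge_le:
  fixes X :: "'a \<Rightarrow> real"
  assumes [measurable]: "X \<in> borel_measurable M" and "\<P>(w in M. a \<le> X w) \<le> 1 - t"
  shows "t \<le> \<P>(w in M. X w \<le> a)"
proof -
  have "\<P>(w in M. \<not> X w \<le> a) \<le> \<P>(w in M. a \<le> X w)"
    by (intro finite_measure_mono) auto
  thus ?thesis using assms(2) by (subst (asm) prob_neg) auto
qed

text \<open>
  Markov's inequality for \<open>(X - \<mu> + u)\<^sup>2\<close>, where \<open>u = variance X / r\<close> is the shift that
  minimizes the resulting bound.
\<close>

lemma cantelli:
  fixes X :: "'a \<Rightarrow> real"
  assumes X: "integrable M X" and X2: "integrable M (\<lambda>w. (X w - expectation X)\<^sup>2)" and r: "0 < r"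
  shows "\<P>(w in M. expectation X + r \<le> X w) \<le> variance X / (variance X + r\<^sup>2)"
proof -
  define m v where "m = expectation X" and "v = variance X"
  have v0: "0 \<le> v" by (simp add: v_def)
  define u where "u = v / r"
  have u0: "0 \<le> u" using v0 r by (simp add: u_def)
  have X2': "integrable M (\<lambda>w. (X w - m)\<^sup>2)" using X2 by (simp add: m_def)
  have sq: "(X w - m + u)\<^sup>2 = (X w - m)\<^sup>2 + (2 * u * (X w - m) + u\<^sup>2)" for w
    by (simp add: power2_eq_square algebra_simps)
  have int: "integrable M (\<lambda>w. (X w - m + u)\<^sup>2)"
    unfolding sq using X X2' by simp
  have "expectation (\<lambda>w. X w - m) = 0" using X by (simp add: m_def prob_space)
  hence E: "expectation (\<lambda>w. (X w - m + u)\<^sup>2) = v + u\<^sup>2"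
    unfolding sq using X X2' by (simp add: v_def m_def prob_space)
  have [measurable]: "X \<in> borel_measurable M" using X by simp
  have "\<P>(w in M. m + r \<le> X w) \<le> \<P>(w in M. (r + u)\<^sup>2 \<le> (X w - m + u)\<^sup>2)"
    using r u0 by (intro finite_measure_mono) (auto intro!: power_mono)
  also have "\<dots> \<le> expectation (\<lambda>w. (X w - m + u)\<^sup>2) / (r + u)\<^sup>2"
    using r u0 int by (intro integral_Markov_inequality_measure[of _ _ "{}"]) auto
  also have "\<dots> = v / (v + r\<^sup>2)"
  proof -
    have "r + u = (v + r\<^sup>2) / r" using r by (simp add: u_def field_simps power2_eq_square)
    moreover have "v + u\<^sup>2 = v * (v + r\<^sup>2) / r\<^sup>2"
      using r by (simp add: u_def field_simps power2_eq_square)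
    moreover have "0 < v + r\<^sup>2" using v0 r by (simp add: add_nonneg_pos)
    ultimately show ?thesis using r unfolding E by (simp add: power_divide) (simp add: power2_eq_square)
  qed
  finally show ?thesis by (simp add: m_def v_def)
qed

text \<open>
  For \<open>r > 0\<close> this is the Cantelli bound solved for \<open>r\<close>. The degenerate case \<open>r = 0\<close> forces
  the variance to vanish, so that \<open>X\<close> is almost surely constant.
\<close>

lemma quantile_bound_cantelli:
  fixes X :: "'a \<Rightarrow> real"
  assumes X: "integrable M X" and X2: "integrable M (\<lambda>w. (X w - expectation X)\<^sup>2)"
    and s: "0 \<le> s" "s\<^sup>2 = variance X"
  shows "quantile_bound M X (expectation X) (\<lambda>t. sqrt (t / (1 - t))) s"
  unfolding quantile_bound_def
proof (intro allI impI)
  fix t r :: real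
  assume t: "0 < t" "t < 1" and r: "sqrt (t / (1 - t)) * s \<le> r"
  have [measurable]: "X \<in> borel_measurable M" using X by simp
  have "0 \<le> sqrt (t / (1 - t)) * s" using s t by simp
  hence r0: "0 \<le> r" using r by linarith
  show "t \<le> \<P>(w in M. X w \<le> expectation X + r)"
  proof (cases "r = 0")
    case False
    hence rp: "0 < r" using r0 by simp
    have "(sqrt (t / (1 - t)) * s)\<^sup>2 \<le> r\<^sup>2" using r s t by (intro power_mono) auto
    hence "t / (1 - t) * s\<^sup>2 \<le> r\<^sup>2" using t by (simp add: power_mult_distrib)
    hence "s\<^sup>2 \<le> (1 - t) * (s\<^sup>2 + r\<^sup>2)" using t by (simp add: field_simps)
    moreover have "0 < s\<^sup>2 + r\<^sup>2" using rp by (simp add: add_nonneg_pos)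
    ultimately have "s\<^sup>2 / (s\<^sup>2 + r\<^sup>2) \<le> 1 - t" by (simp add: pos_divide_le_eq)
    thus ?thesis
      using cantelli[OF X X2 rp] s by (intro prob_le_ge_if_prob_ge_le) auto
  next
    case True
    have "sqrt (t / (1 - t)) > 0" using t by simp
    hence "s = 0" using r True s by (auto simp: mult_le_0_iff)
    hence "AE w in M. (X w - expectation X)\<^sup>2 = 0"
      using X2 s integral_nonneg_eq_0_iff_AE[OF X2] by simp
    hence "AE w in M. X w \<le> expectation X + r"
      by eventually_elim (use True in simp)
    hence "\<P>(w in M. X w \<le> expectation X + r) = 1" by (subst prob_Collect_eq_1) auto
    thus ?thesis using t by simp
  qed
qed

text \<open>
  With parameter 0 the centred variable \<open>Y\<close> satisfies \<open>E (exp Y) \<le> 1 = E (1 + Y)\<close>,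
  although \<open>exp Y \<ge> 1 + Y\<close> pointwise with equality only at \<open>Y = 0\<close>.
\<close>

lemma sub_gaussian_zero_imp_AE_const:
  assumes "sub_gaussian M X 0"
  shows "AE w in M. X w = expectation X"
proof -
  define Y where "Y = (\<lambda>w. X w - expectation X)"
  have X: "integrable M X" and eY: "integrable M (\<lambda>w. exp (Y w))" "expectation (\<lambda>w. exp (Y w)) \<le> 1"
    using assms spec[of "\<lambda>t. integrable M (\<lambda>w. exp (t * (X w - integral\<^sup>L M X))) \<and>
          integral\<^sup>L M (\<lambda>w. exp (t * (X w - integral\<^sup>L M X))) \<le> exp (0\<^sup>2 * t\<^sup>2 / 2)" 1]
    by (auto simp: sub_gaussian_def Y_def)
  have Y: "integrable M Y" "expectation Y = 0" using X by (simp_all add: Y_def prob_space)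
  have nn: "0 \<le> exp (Y w) - 1 - Y w" for w using exp_ge_add_one_self[of "Y w"] by linarith
  have int: "integrable M (\<lambda>w. exp (Y w) - 1 - Y w)" using eY Y by simp
  have "expectation (\<lambda>w. exp (Y w) - 1 - Y w) \<le> 0" using eY Y by (simp add: prob_space)
  moreover have "0 \<le> expectation (\<lambda>w. exp (Y w) - 1 - Y w)" using nn by (intro Bochner_Integration.integral_nonneg)
  ultimately have "AE w in M. exp (Y w) - 1 - Y w = 0"
    using int nn by (subst integral_nonneg_eq_0_iff_AE[symmetric]) auto
  thus ?thesis
  proof eventually_elim
    case (elim w)
    hence "exp (Y w) = 1" by (intro ln_eq_minus_one) auto
    thus ?case by (simp add: Y_def)
  qed
qed

text \<open>
  The Chernoff bound with the optimal exponent \<open>r / s\<^sup>2\<close>, solved for \<open>r\<close>.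
\<close>

lemma quantile_bound_sub_gaussian:
  assumes "sub_gaussian M X s"
  shows "quantile_bound M X (expectation X) (\<lambda>t. sqrt (- 2 * ln (1 - t))) s"
  unfolding quantile_bound_def
proof (intro allI impI)
  fix t r :: real
  assume t: "0 < t" "t < 1" and r: "sqrt (- 2 * ln (1 - t)) * s \<le> r"
  have s: "0 \<le> s" and X: "integrable M X" using assms by (auto simp: sub_gaussian_def)
  have [measurable]: "X \<in> borel_measurable M" using X by simp
  have l: "0 < - 2 * ln (1 - t)" using t by simp
  have r0: "0 \<le> r" using r s l by (meson mult_nonneg_nonneg order_trans real_sqrt_ge_zero less_imp_le)
  show "t \<le> \<P>(w in M. X w \<le> expectation X + r)"
  proof (cases "s = 0")
    case True
    hence "AE w in M. X w \<le> expectation X + r"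
      using sub_gaussian_zero_imp_AE_const[of X] assms r0 by auto
    hence "\<P>(w in M. X w \<le> expectation X + r) = 1" by (subst prob_Collect_eq_1) auto
    thus ?thesis using t by simp
  next
    case False
    hence sp: "0 < s" using s by simp
    have rp: "0 < r" using r sp l by (meson mult_pos_pos less_le_trans real_sqrt_gt_zero)
    define b where "b = r / s\<^sup>2"
    have b: "0 < b" using rp sp by (simp add: b_def)
    let ?Y = "\<lambda>w. X w - expectation X"
    have mgf: "integrable M (\<lambda>w. exp (b * ?Y w))" "expectation (\<lambda>w. exp (b * ?Y w)) \<le> exp (s\<^sup>2 * b\<^sup>2 / 2)"
      using assms by (auto simp: sub_gaussian_def)
    have "\<P>(w in M. expectation X + r \<le> X w) = \<P>(w in M. exp (b * r) \<le> exp (b * ?Y w))"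
      using b by (intro arg_cong[where f = prob]) auto
    also have "\<dots> \<le> expectation (\<lambda>w. exp (b * ?Y w)) / exp (b * r)"
      using mgf by (intro integral_Markov_inequality_measure[of _ _ "{}"]) auto
    also have "\<dots> \<le> exp (s\<^sup>2 * b\<^sup>2 / 2) / exp (b * r)" using mgf by (intro divide_right_mono) auto
    also have "\<dots> = exp (- (r\<^sup>2 / (2 * s\<^sup>2)))"
      using sp by (simp add: b_def exp_diff[symmetric] field_simps power2_eq_square)
    also have "\<dots> \<le> 1 - t"
    proof -
      have "(sqrt (- 2 * ln (1 - t)) * s)\<^sup>2 \<le> r\<^sup>2" using r s l by (intro power_mono) auto
      hence "- 2 * ln (1 - t) * s\<^sup>2 \<le> r\<^sup>2" using l by (simp add: power_mult_distrib)
      hence "- (r\<^sup>2 / (2 * s\<^sup>2)) \<le> ln (1 - t)" using sp by (simp add: field_simps)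
      hence "exp (- (r\<^sup>2 / (2 * s\<^sup>2))) \<le> exp (ln (1 - t))" by (simp only: exp_le_cancel_iff)
      thus ?thesis using t by simp
    qed
    finally show ?thesis by (intro prob_le_ge_if_prob_ge_le) auto
  qed
qed

lemma expectation_inner:
  fixes X :: "'a \<Rightarrow> real^'k"
  assumes "\<And>i. integrable M (\<lambda>w. X w $ i)"
  shows "integrable M (\<lambda>w. x \<bullet> X w)" "expectation (\<lambda>w. x \<bullet> X w) = x \<bullet> mean_vec M X"
  using assms by (simp_all add: inner_vec_def mean_vec_def)

text \<open>
  Moment generating functions of independent variables multiply, so the squared parameters of
  the summands add up.
\<close>

lemma sub_gaussian_inner:
  fixes X :: "'a \<Rightarrow> real^'k"
  assumes ind: "indep_components M X"
    and sg: "\<And>i. sub_gaussian M (\<lambda>w. X w $ i) (s $ i)"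
  shows "sub_gaussian M (\<lambda>w. x \<bullet> X w) (L2_set (\<lambda>i. x $ i * s $ i) UNIV)"
proof -
  have X: "integrable M (\<lambda>w. X w $ i)" for i using sg by (auto simp: sub_gaussian_def)
  let ?m = "mean_vec M X"
  let ?E = "\<lambda>t i w. exp ((t * x $ i) * (X w $ i - ?m $ i))"
  have E: "integrable M (?E t i)" "expectation (?E t i) \<le> exp ((s $ i)\<^sup>2 * (t * x $ i)\<^sup>2 / 2)" for t i
    using sg[of i] unfolding sub_gaussian_def by (simp_all add: mean_vec_def)
  have prod: "exp (t * (x \<bullet> X w - expectation (\<lambda>w. x \<bullet> X w))) = (\<Prod>i\<in>UNIV. ?E t i w)" for t w
    unfolding expectation_inner(2)[OF X]
    by (simp add: exp_sum[symmetric] inner_vec_def sum_subtractf[symmetric] sum_distrib_left algebra_simps)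
  have indE: "indep_vars (\<lambda>_. borel) (?E t) UNIV" for t
    using ind unfolding indep_components_def
    by (rule indep_vars_compose2[where Y = "\<lambda>i y. exp ((t * x $ i) * (y - ?m $ i))"]) simp
  have "expectation (\<lambda>w. exp (t * (x \<bullet> X w - expectation (\<lambda>w. x \<bullet> X w))))
      \<le> exp ((L2_set (\<lambda>i. x $ i * s $ i) UNIV)\<^sup>2 * t\<^sup>2 / 2)" for t
  proof -
    have "expectation (\<lambda>w. exp (t * (x \<bullet> X w - expectation (\<lambda>w. x \<bullet> X w))))
        = (\<Prod>i\<in>UNIV. expectation (?E t i))"
      unfolding prod by (rule indep_vars_lebesgue_integral[OF _ indE E(1)]) simp
    also have "\<dots> \<le> (\<Prod>i\<in>UNIV. exp ((s $ i)\<^sup>2 * (t * x $ i)\<^sup>2 / 2))"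
      using E(2) by (intro prod_mono) auto
    also have "\<dots> = exp ((L2_set (\<lambda>i. x $ i * s $ i) UNIV)\<^sup>2 * t\<^sup>2 / 2)"
      by (simp add: exp_sum[symmetric] L2_set_def sum_nonneg sum_distrib_right sum_divide_distrib
          sum_distrib_left power_mult_distrib mult_ac)
    finally show ?thesis .
  qed
  moreover have "integrable M (\<lambda>w. exp (t * (x \<bullet> X w - expectation (\<lambda>w. x \<bullet> X w))))" for t
    unfolding prod by (rule indep_vars_integrable[OF _ indE E(1)]) simp
  ultimately show ?thesis
    unfolding sub_gaussian_def using expectation_inner(1)[OF X] by simp
qed

text \<open>
  Hoeffding's lemma. It is applied to \<open>- X\<close> as well, in order to cover negative exponents.
\<close>

lemma bounded_imp_sub_gaussian:
  assumes [measurable]: "X \<in> borel_measurable M" and b: "\<And>w. w \<in> space M \<Longrightarrow> l \<le> X w \<and> X w \<le> u"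
  shows "sub_gaussian M X ((u - l) / 2)"
proof -
  obtain w where "w \<in> space M" using not_empty by blast
  with b[of w] have lu: "l \<le> u" by simp
  interpret X: interval_bounded_random_variable M X l u
    by unfold_locales (use b in auto)
  interpret nX: interval_bounded_random_variable M "\<lambda>w. - X w" "- u" "- l"
    by unfold_locales (use b in auto)
  let ?g = "\<lambda>t w. exp (t * (X w - expectation X))"
  have nn: "(\<integral>\<^sup>+w. ennreal (?g t w) \<partial>M) \<le> ennreal (exp (((u - l) / 2)\<^sup>2 * t\<^sup>2 / 2))" for t
  proof -
    have e: "((u - l) / 2)\<^sup>2 * t\<^sup>2 / 2 = t\<^sup>2 * (u - l)\<^sup>2 / 8" "(- l - - u) = u - l"
      by (simp_all add: power_divide)
    consider "t = 0" | "t > 0" | "- t > 0" by linarith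
    thus ?thesis
    proof cases
      case 1 thus ?thesis by (simp add: emeasure_space_1)
    next
      case 2 thus ?thesis using X.Hoeffdings_lemma_nn_integral[of t] unfolding e by simp
    next
      case 3
      have "(- t) * (- X w - expectation (\<lambda>w. - X w)) = t * (X w - expectation X)" for w
        by (simp add: algebra_simps)
      thus ?thesis using nX.Hoeffdings_lemma_nn_integral[OF 3] unfolding e by simp
    qed
  qed
  have int: "integrable M (?g t)" for t
    using nn[of t] by (intro integrableI_nonneg) (auto simp: less_top[symmetric] top_unique)
  have "expectation (?g t) \<le> exp (((u - l) / 2)\<^sup>2 * t\<^sup>2 / 2)" for t
    using nn[of t] by (subst (asm) nn_integral_eq_integral[OF int]) auto
  thus ?thesis using lu int X.integrable by (simp add: sub_gaussian_def)
qed

text \<open>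
  The covariance matrix represents the variances of all linear combinations; this also shows
  that it is positive semidefinite.
\<close>

lemma covariance_quadratic_form:
  fixes X :: "'a \<Rightarrow> real^'k"
  assumes X: "has_mean_cov M X"
  shows "integrable M (\<lambda>w. (x \<bullet> X w - expectation (\<lambda>w. x \<bullet> X w))\<^sup>2)"
    and "variance (\<lambda>w. x \<bullet> X w) = x \<bullet> (cov_mat M X *v x)"
proof -
  let ?m = "mean_vec M X"
  have i: "\<And>i. integrable M (\<lambda>w. X w $ i)"
    and ij: "\<And>i j. integrable M (\<lambda>w. (X w $ i - ?m $ i) * (X w $ j - ?m $ j))"
    using X by (auto simp: has_mean_cov_def)
  have eq: "(x \<bullet> X w - expectation (\<lambda>w. x \<bullet> X w))\<^sup>2 =
      (\<Sum>i\<in>UNIV. \<Sum>j\<in>UNIV. x $ i * x $ j * ((X w $ i - ?m $ i) * (X w $ j - ?m $ j)))" for w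
  proof -
    have "x \<bullet> X w - expectation (\<lambda>w. x \<bullet> X w) = (\<Sum>i\<in>UNIV. x $ i * (X w $ i - ?m $ i))"
      unfolding expectation_inner(2)[OF i]
      by (simp add: inner_vec_def sum_subtractf[symmetric] algebra_simps)
    thus ?thesis by (simp add: power2_eq_square sum_product mult_ac)
  qed
  show "integrable M (\<lambda>w. (x \<bullet> X w - expectation (\<lambda>w. x \<bullet> X w))\<^sup>2)"
    unfolding eq using ij by simp
  show "variance (\<lambda>w. x \<bullet> X w) = x \<bullet> (cov_mat M X *v x)"
    unfolding eq using ij
    by (simp add: cov_mat_def inner_vec_def matrix_vector_mult_def sum_distrib_left mult_ac)
qed

lemma psd_cov_mat:
  assumes "has_mean_cov M X"
  shows "psd (cov_mat M X)"
  unfolding psd_def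
proof (intro conjI allI)
  show "transpose (cov_mat M X) = cov_mat M X"
    by (simp add: transpose_def cov_mat_def mult.commute)
  show "0 \<le> x \<bullet> (cov_mat M X *v x)" for x
    unfolding covariance_quadratic_form(2)[OF assms, symmetric] by simp
qed

end

lemma inner_moment_quantile_bound:
  fixes X :: "'w \<Rightarrow> real^'k"
  assumes M: "prob_space M" and X: "has_mean_cov M X"
  shows "quantile_bound M (\<lambda>w. \<rho> \<bullet> X w) (\<rho> \<bullet> mean_vec M X) (\<lambda>q. sqrt (q / (1 - q)))
           (norm (psd_sqrt (cov_mat M X) *v \<rho>))"
proof -
  interpret prob_space M by fact
  have i: "\<And>i. integrable M (\<lambda>w. X w $ i)" using X by (simp add: has_mean_cov_def)
  have "(norm (psd_sqrt (cov_mat M X) *v \<rho>))\<^sup>2 = variance (\<lambda>w. \<rho> \<bullet> X w)"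
    unfolding covariance_quadratic_form(2)[OF X] by (rule norm_psd_sqrt_mult_squared[OF psd_cov_mat[OF X]])
  from quantile_bound_cantelli[OF expectation_inner(1)[OF i] covariance_quadratic_form(1)[OF X] norm_ge_zero this]
  show ?thesis by (simp only: expectation_inner(2)[OF i])
qed

lemma inner_sub_gaussian_quantile_bound:
  fixes X :: "'w \<Rightarrow> real^'k"
  assumes M: "prob_space M" and ind: "indep_components M X"
    and sg: "\<And>i. sub_gaussian M (\<lambda>w. X w $ i) (s $ i)"
  shows "quantile_bound M (\<lambda>w. \<rho> \<bullet> X w) (\<rho> \<bullet> mean_vec M X) (\<lambda>q. sqrt (- 2 * ln (1 - q)))
           (L2_set (\<lambda>i. \<rho> $ i * s $ i) UNIV)"
proof -
  interpret prob_space M by fact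
  have i: "\<And>i. integrable M (\<lambda>w. X w $ i)" using sg by (simp add: sub_gaussian_def)
  from quantile_bound_sub_gaussian[OF sub_gaussian_inner[OF ind sg]]
  show ?thesis by (simp only: expectation_inner(2)[OF i])
qed

text \<open>
  The sub-Gaussian parameter is half the range; the factor \<open>1/2\<close> moves from the dispersion into
  the square root, where it turns the constant 2 into \<open>1/2\<close>.
\<close>

lemma inner_bounded_quantile_bound:
  fixes X :: "'w \<Rightarrow> real^'k"
  assumes M: "prob_space M" and X: "X \<in> borel_measurable M" and ind: "indep_components M X"
    and b: "bounded_by M X l u"
  shows "quantile_bound M (\<lambda>w. \<rho> \<bullet> X w) (\<rho> \<bullet> mean_vec M X) (\<lambda>q. sqrt (- (1/2) * ln (1 - q)))
           (L2_set (\<lambda>i. \<rho> $ i * (u - l) $ i) UNIV)"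
proof -
  interpret prob_space M by fact
  have "sub_gaussian M (\<lambda>w. X w $ i) (((1/2) *\<^sub>R (u - l)) $ i)" for i
  proof -
    have "(\<lambda>w. X w $ i) \<in> borel_measurable M"
      by (intro measurable_compose[OF X] borel_measurable_continuous_onI continuous_intros)
    hence "sub_gaussian M (\<lambda>w. X w $ i) ((u $ i - l $ i) / 2)"
      by (rule bounded_imp_sub_gaussian) (use b in \<open>auto simp: bounded_by_def\<close>)
    thus ?thesis by simp
  qed
  from inner_sub_gaussian_quantile_bound[OF M ind this]
  have "quantile_bound M (\<lambda>w. \<rho> \<bullet> X w) (\<rho> \<bullet> mean_vec M X) (\<lambda>q. sqrt (- 2 * ln (1 - q)))
      (L2_set (\<lambda>i. (1/2) * (\<rho> $ i * (u - l) $ i)) UNIV)"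
    by (simp add: mult_ac)
  also have "L2_set (\<lambda>i. (1/2) * (\<rho> $ i * (u - l) $ i)) UNIV = (1/2) * L2_set (\<lambda>i. \<rho> $ i * (u - l) $ i) UNIV"
    by (rule L2_set_right_distrib[symmetric]) simp
  finally have qb: "quantile_bound M (\<lambda>w. \<rho> \<bullet> X w) (\<rho> \<bullet> mean_vec M X) (\<lambda>q. sqrt (- 2 * ln (1 - q)))
      ((1/2) * L2_set (\<lambda>i. \<rho> $ i * (u - l) $ i) UNIV)" .
  have "sqrt (- 2 * ln (1 - t)) = 2 * sqrt (- (1/2) * ln (1 - t))" for t
  proof -
    have "sqrt (- 2 * ln (1 - t)) = sqrt (4 * (- (1/2) * ln (1 - t)))" by simp
    also have "\<dots> = 2 * sqrt (- (1/2) * ln (1 - t))" by (subst real_sqrt_mult) simp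
    finally show ?thesis .
  qed
  thus ?thesis using qb unfolding quantile_bound_def by simp
qed

section \<open>Convexity of the risk factors\<close>

lemma convex_on_compose_linear:
  assumes "linear L" "convex_on C h"
  shows "convex_on (L -` C) (\<lambda>x. h (L x))"
  using assms convex_linear_vimage[OF assms(1), of C]
  by (auto simp: convex_on_def linear_add linear_scale)

lemma convex_on_norm_linear:
  assumes "linear L"
  shows "convex_on UNIV (\<lambda>x. norm (L x))"
proof -
  have "convex_on UNIV (\<lambda>x::'b. norm x)"
    using convex_on_dist[of UNIV "0::'b"] by simp
  from convex_on_compose_linear[OF assms this] show ?thesis by simp
qed

lemma convex_on_eq_on:
  assumes "convex_on C f" and eq: "\<And>x. x \<in> C \<Longrightarrow> g x = f x"
  shows "convex_on C g"
  unfolding convex_on_def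
proof (intro conjI ballI allI impI)
  show C: "convex C" using assms(1) by (simp add: convex_on_def)
  fix x y and u v :: real
  assume "x \<in> C" "y \<in> C" "0 \<le> u" "0 \<le> v" "u + v = 1"
  moreover from this have "u *\<^sub>R x + v *\<^sub>R y \<in> C" using C by (simp add: convexD)
  ultimately show "g (u *\<^sub>R x + v *\<^sub>R y) \<le> u * g x + v * g y"
    using assms(1) by (simp add: eq convex_on_def)
qed

lemma convex_on_linear: "linear L \<Longrightarrow> convex_on UNIV L"
  for L :: "'v::real_vector \<Rightarrow> real"
  by (simp add: convex_on_def linear_add linear_scale)

text \<open>
  Extending by \<open>\<infinity>\<close> outside of the domain keeps convexity; at the endpoints \<open>u = 0\<close> and
  \<open>v = 0\<close> this relies on \<open>0 * \<infinity> = 0\<close>.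
\<close>

lemma convex_ext_if:
  assumes f: "convex_on D f"
  shows "convex_ext (\<lambda>x. if x \<in> D then ereal (f x) else \<infinity>)"
  unfolding convex_ext_def
proof (intro conjI allI impI)
  fix x y and u v :: real
  assume uv: "0 \<le> u \<and> 0 \<le> v \<and> u + v = 1"
  let ?g = "\<lambda>x. if x \<in> D then ereal (f x) else \<infinity>"
  consider "u = 0" "v = 1" | "u = 1" "v = 0" | "0 < u" "0 < v" using uv by linarith
  thus "?g (u *\<^sub>R x + v *\<^sub>R y) \<le> ereal u * ?g x + ereal v * ?g y"
  proof cases
    case 3
    show ?thesis
    proof (cases "x \<in> D \<and> y \<in> D")
      case True
      hence "u *\<^sub>R x + v *\<^sub>R y \<in> D" "f (u *\<^sub>R x + v *\<^sub>R y) \<le> u * f x + v * f y"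
        using f uv by (auto simp: convex_on_def convex_def)
      thus ?thesis using True by simp
    qed (use 3 in auto)
  qed (auto simp: zero_ereal_def[symmetric] one_ereal_def[symmetric])
qed auto

lemma convex_ext_ereal: "convex_on UNIV f \<Longrightarrow> convex_ext (\<lambda>x. ereal (f x))"
  using convex_ext_if[of UNIV f] by simp

lemma concave_on_powr:
  assumes "0 \<le> a" "a \<le> 1"
  shows "concave_on {0<..} (\<lambda>x::real. x powr a)"
proof (rule f''_le0_imp_concave)
  fix x :: real assume "x \<in> {0<..}"
  hence x: "0 < x" by simp
  show "((\<lambda>x. x powr a) has_real_derivative a * x powr (a - 1)) (at x)"
    using x by (auto intro!: derivative_eq_intros)
  show "((\<lambda>x. a * x powr (a - 1)) has_real_derivative a * ((a - 1) * x powr (a - 1 - 1))) (at x)"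
    using x by (auto intro!: derivative_eq_intros)
  show "a * ((a - 1) * x powr (a - 1 - 1)) \<le> 0"
    using assms by (simp add: mult_nonneg_nonpos mult_nonpos_nonneg)
qed simp

lemma convex_on_antimono_concave:
  fixes g :: "'a::real_vector \<Rightarrow> real"
  assumes h: "convex_on C h" "antimono_on C h" and g: "concave_on S g" "g ` S \<subseteq> C"
  shows "convex_on S (\<lambda>x. h (g x))"
  unfolding convex_on_def
proof (intro conjI ballI allI impI)
  show S: "convex S" using g(1) by (rule concave_on_imp_convex)
  fix x y and u v :: real
  assume xy: "x \<in> S" "y \<in> S" and uv: "0 \<le> u" "0 \<le> v" "u + v = 1"
  have C: "convex C" using h(1) by (simp add: convex_on_def)
  have "u *\<^sub>R x + v *\<^sub>R y \<in> S" using S xy uv by (auto simp: convex_def)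
  moreover have "u * g x + v * g y \<in> C" using C xy uv g(2) by (auto simp: convex_def image_subset_iff)
  moreover have "u * g x + v * g y \<le> g (u *\<^sub>R x + v *\<^sub>R y)"
    using g(1) xy uv by (auto simp: concave_on_iff)
  ultimately have "h (g (u *\<^sub>R x + v *\<^sub>R y)) \<le> h (u * g x + v * g y)"
    using h(2) g(2) by (auto simp: monotone_on_def image_subset_iff)
  also have "\<dots> \<le> u * h (g x) + v * h (g y)"
    using h(1) xy uv g(2) by (auto simp: convex_on_def image_subset_iff)
  finally show "h (g (u *\<^sub>R x + v *\<^sub>R y)) \<le> u * h (g x) + v * h (g y)" .
qed

lemma level_eq_exp: "0 < pr \<Longrightarrow> level \<theta> pr y = exp (- (- ln pr * y powr (1 / \<theta>)))"
  by (simp add: level_def powr_def)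

text \<open>
  In the variable \<open>t = - ln pr * y powr (1 / \<theta>)\<close>, which is concave in \<open>y\<close>, the level is
  \<open>exp (- t)\<close>. Hence it is enough to study \<open>q (exp (- t))\<close> as a function of \<open>t > 0\<close>.
\<close>

lemma convex_on_quantile_level:
  assumes pr: "0 < pr" "pr < 1" and \<theta>: "1 \<le> \<theta>"
    and q: "convex_on {0<..} (\<lambda>t. q (exp (- t)))" "antimono_on {0<..} (\<lambda>t. q (exp (- t)))"
  shows "convex_on {0<..1} (\<lambda>y. q (level \<theta> pr y))"
proof -
  have l: "0 < - ln pr" using pr by simp
  have "concave_on {0<..1} (\<lambda>y. y powr (1 / \<theta>))"
    unfolding concave_on_def
  proof (rule convex_on_subset)
    show "convex_on {0<..} (\<lambda>y. - (y powr (1 / \<theta>)))"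
      using concave_on_powr[of "1 / \<theta>"] \<theta> by (simp add: concave_on_def)
  qed auto
  hence "concave_on {0<..1} (\<lambda>y. - ln pr * y powr (1 / \<theta>))"
    using l by (intro concave_on_cmul) auto
  moreover have "(\<lambda>y. - ln pr * y powr (1 / \<theta>)) ` {0<..1} \<subseteq> {0<..}"
    unfolding image_subset_iff using l by (auto intro: mult_neg_pos)
  ultimately show ?thesis
    using convex_on_antimono_concave[OF q] pr(1) by (simp only: level_eq_exp)
qed

text \<open>
  The function is \<open>1 / sqrt (exp t - 1)\<close>; minus its derivative is a product of positive
  decreasing functions.
\<close>

lemma convex_antimono_odds:
  shows "convex_on {0<..} (\<lambda>t::real. sqrt (exp (- t) / (1 - exp (- t))))" (is ?convex)
    and "antimono_on {0<..} (\<lambda>t::real. sqrt (exp (- t) / (1 - exp (- t))))" (is ?anti)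
proof -
  have eq: "sqrt (exp (- t) / (1 - exp (- t))) = 1 / sqrt (exp t - 1)" if "0 < t" for t :: real
  proof -
    have "exp (- t) / (1 - exp (- t)) = 1 / (exp t - 1)"
      using that by (simp add: exp_minus field_simps)
    thus ?thesis by (simp add: real_sqrt_divide)
  qed
  have "convex_on {0<..} (\<lambda>t::real. 1 / sqrt (exp t - 1))"
  proof (rule convex_on_realI)
    fix t :: real assume "t \<in> {0<..}"
    hence e: "0 < exp t - 1" by simp
    have "sqrt (exp t - 1) * sqrt (exp t - 1) = exp t - 1" using e by simp
    thus "((\<lambda>t. 1 / sqrt (exp t - 1)) has_real_derivative
        - (1 / 2 * (1 + 1 / (exp t - 1)) * (1 / sqrt (exp t - 1)))) (at t)"
      using e by (auto intro!: derivative_eq_intros simp: field_simps)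
  next
    fix x y :: real assume "x \<in> {0<..}" "y \<in> {0<..}" "x \<le> y"
    hence "0 < exp x - 1" "exp x - 1 \<le> exp y - 1" by auto
    thus "- (1 / 2 * (1 + 1 / (exp x - 1)) * (1 / sqrt (exp x - 1)))
        \<le> - (1 / 2 * (1 + 1 / (exp y - 1)) * (1 / sqrt (exp y - 1)))"
      by (intro le_imp_neg_le mult_mono add_mono frac_le real_sqrt_le_mono) auto
  qed auto
  thus ?convex by (rule convex_on_eq_on) (simp add: eq)
  show ?anti
    by (auto simp: monotone_on_def eq intro!: divide_left_mono mult_pos_pos)
qed

text \<open>
  With \<open>g t = - ln (1 - exp (- t))\<close>, the derivative of \<open>sqrt (g t)\<close> is
  \<open>- 1 / (2 * sqrt (W t))\<close> for \<open>W t = (exp t - 1)\<^sup>2 * g t\<close>. It is increasing because \<open>W\<close> is: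
  the sign of the derivative of \<open>W\<close> is that of \<open>2 * exp t * g t - 1\<close>, which is positive by
  \<open>g t \<ge> exp (- t)\<close>.
\<close>

lemma convex_antimono_sqrt_log:
  assumes a: "0 \<le> a"
  shows "convex_on {0<..} (\<lambda>t::real. sqrt (- a * ln (1 - exp (- t))))" (is ?convex)
    and "antimono_on {0<..} (\<lambda>t::real. sqrt (- a * ln (1 - exp (- t))))" (is ?anti)
proof -
  define g where "g = (\<lambda>t::real. - ln (1 - exp (- t)))"
  have g: "0 < g t" "exp (- t) \<le> g t" if "0 < t" for t
  proof -
    have "ln (1 - exp (- t)) \<le> (1 - exp (- t)) - 1" using that by (intro ln_le_minus_one) auto
    thus "exp (- t) \<le> g t" by (simp add: g_def)
    thus "0 < g t" by (smt (verit) exp_gt_zero)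
  qed
  have dg: "(g has_real_derivative - (1 / (exp t - 1))) (at t)" if "0 < t" for t
    using that unfolding g_def
    by (auto intro!: derivative_eq_intros simp: exp_minus field_simps)
  define W where "W = (\<lambda>t. (exp t - 1)\<^sup>2 * g t)"
  have W_mono: "W x \<le> W y" if xy: "0 < x" "x \<le> y" for x y
  proof (rule DERIV_nonneg_imp_nondecreasing[OF xy(2)])
    fix t assume "x \<le> t" "t \<le> y"
    hence t: "0 < t" using xy by simp
    have e: "0 < exp t - 1" using t by simp
    have "- (1 / (exp t - 1)) * (exp t - 1)\<^sup>2 = - (exp t - 1)"
      using e by (simp add: power2_eq_square)
    hence "2 * (exp t - 1) * exp t * g t + - (1 / (exp t - 1)) * (exp t - 1)\<^sup>2 =
        (exp t - 1) * (2 * exp t * g t - 1)"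
      by (simp only:) (simp add: algebra_simps)
    moreover from e have "((\<lambda>t. (exp t - 1)\<^sup>2) has_real_derivative 2 * (exp t - 1) * exp t) (at t)"
      by (auto intro!: derivative_eq_intros)
    from DERIV_mult[OF this dg[OF t]] have "(W has_real_derivative
        2 * (exp t - 1) * exp t * g t + - (1 / (exp t - 1)) * (exp t - 1)\<^sup>2) (at t)"
      by (simp only: W_def)
    ultimately have "(W has_real_derivative (exp t - 1) * (2 * exp t * g t - 1)) (at t)"
      by (simp only:)
    moreover have "exp t * exp (- t) \<le> exp t * g t" using g(2)[OF t] by (intro mult_left_mono) auto
    hence "1 \<le> exp t * g t" by (simp add: exp_minus)
    hence "0 \<le> (exp t - 1) * (2 * exp t * g t - 1)" using e by (intro mult_nonneg_nonneg) auto
    ultimately show "\<exists>z. (W has_real_derivative z) (at t) \<and> 0 \<le> z" by blast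
  qed
  have W_eq: "sqrt (W t) = (exp t - 1) * sqrt (g t)" if "0 < t" for t
    using that by (simp add: W_def real_sqrt_mult)
  have W_pos: "0 < W t" if "0 < t" for t using g[OF that] that by (simp add: W_def)
  have conv: "convex_on {0<..} (\<lambda>t. sqrt (g t))"
  proof (rule convex_on_realI)
    fix t :: real assume "t \<in> {0<..}"
    hence t: "0 < t" by simp
    have "0 < exp t - 1" using t by simp
    thus "((\<lambda>t. sqrt (g t)) has_real_derivative - (1 / (2 * sqrt (W t)))) (at t)"
      using g(1)[OF t] unfolding W_eq[OF t]
      by (auto intro!: derivative_eq_intros dg[OF t] simp: field_simps)
  next
    fix x y :: real assume "x \<in> {0<..}" "y \<in> {0<..}" "x \<le> y"
    thus "- (1 / (2 * sqrt (W x))) \<le> - (1 / (2 * sqrt (W y)))"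
      using W_mono[of x y] W_pos[of x] by (auto intro!: divide_left_mono mult_pos_pos dest: W_pos)
  qed auto
  have eq: "sqrt (- a * ln (1 - exp (- t))) = sqrt a * sqrt (g t)" for t
    by (simp add: g_def real_sqrt_mult[symmetric])
  show ?convex unfolding eq using a conv by (intro convex_on_cmul) auto
  show ?anti unfolding eq monotone_on_def
  proof (intro ballI impI mult_left_mono real_sqrt_le_mono)
    fix x y :: real assume "x \<in> {0<..}" "y \<in> {0<..}" "x \<le> y"
    thus "g y \<le> g x" by (simp add: g_def)
  qed (use a in auto)
qed

section \<open>Occupation measures\<close>

context
  fixes S :: "'s set" and A :: "'s \<Rightarrow> 'a set" and pr :: "'k::finite \<Rightarrow> 's \<times> 'a"
    and p :: "'s \<Rightarrow> 'a \<Rightarrow> 's pmf" and \<gamma> :: "'s pmf" and \<alpha> :: real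
  assumes mdp: "mdp S A pr p \<gamma>" and \<alpha>: "0 < \<alpha>" "\<alpha> < 1"
begin

text \<open>
  The discounted state frequencies of the stationary policy \<open>act\<close>: \<open>N t\<close> is the distribution of
  the state at time \<open>t\<close>, and \<open>x\<close> is the series of the \<open>N t\<close> with weights
  \<open>(1 - \<alpha>) * \<alpha> ^ t\<close>. Splitting off the initial term gives the balance equation.
\<close>

lemma discounted_visits_exist:
  assumes act: "\<And>s. s \<in> S \<Longrightarrow> act s \<in> A s"
  obtains x :: "'s \<Rightarrow> real" where "\<And>s. 0 \<le> x s"
    and "\<And>s'. x s' = (1 - \<alpha>) * pmf \<gamma> s' + \<alpha> * (\<Sum>s\<in>S. x s * pmf (p s (act s)) s')"
proof -
  have S: "finite S" "\<And>s a. s \<in> S \<Longrightarrow> a \<in> A s \<Longrightarrow> set_pmf (p s a) \<subseteq> S" "set_pmf \<gamma> \<subseteq> S"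
    using mdp by (auto simp: mdp_def)
  define N where "N = (\<lambda>t. ((\<lambda>\<nu>. bind_pmf \<nu> (\<lambda>s. p s (act s))) ^^ t) \<gamma>)"
  have N_S: "set_pmf (N t) \<subseteq> S" for t
  proof (induction t)
    case 0
    show ?case using S by (simp add: N_def)
  next
    case (Suc t)
    have "set_pmf (N (Suc t)) = (\<Union>s\<in>set_pmf (N t). set_pmf (p s (act s)))" by (simp add: N_def)
    also have "\<dots> \<subseteq> S" using Suc S(2) act by blast
    finally show ?case .
  qed
  have N_Suc: "pmf (N (Suc t)) s' = (\<Sum>s\<in>S. pmf (N t) s * pmf (p s (act s)) s')" for t s'
  proof -
    have "pmf (N (Suc t)) s' = (\<integral>s. pmf (p s (act s)) s' \<partial>measure_pmf (N t))"
      by (simp add: N_def pmf_bind)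
    also have "\<dots> = (\<Sum>s\<in>S. pmf (p s (act s)) s' * pmf (N t) s)"
      using N_S[of t] S(1) by (intro integral_measure_pmf_real) auto
    finally show ?thesis by (simp add: mult.commute)
  qed
  have summ: "summable (\<lambda>t. (1 - \<alpha>) * \<alpha> ^ t * pmf (\<nu> t) s)" for \<nu> :: "nat \<Rightarrow> 's pmf" and s
  proof (rule summable_comparison_test')
    show "summable (\<lambda>t. (1 - \<alpha>) * \<alpha> ^ t)" using \<alpha> by (intro summable_mult summable_geometric) auto
    show "norm ((1 - \<alpha>) * \<alpha> ^ t * pmf (\<nu> t) s) \<le> (1 - \<alpha>) * \<alpha> ^ t" for t
      using \<alpha> by (auto simp: abs_mult pmf_le_1 intro!: mult_left_le)
  qed
  define x where "x = (\<lambda>s. \<Sum>t. (1 - \<alpha>) * \<alpha> ^ t * pmf (N t) s)"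
  show thesis
  proof
    show "0 \<le> x s" for s
      unfolding x_def using \<alpha> by (intro suminf_nonneg summ) auto
    show "x s' = (1 - \<alpha>) * pmf \<gamma> s' + \<alpha> * (\<Sum>s\<in>S. x s * pmf (p s (act s)) s')" for s'
    proof -
      have "(\<Sum>s\<in>S. x s * pmf (p s (act s)) s') =
          (\<Sum>s\<in>S. \<Sum>t. (1 - \<alpha>) * \<alpha> ^ t * pmf (N t) s * pmf (p s (act s)) s')"
        unfolding x_def by (intro sum.cong refl suminf_mult2 summ)
      also have "\<dots> = (\<Sum>t. \<Sum>s\<in>S. (1 - \<alpha>) * \<alpha> ^ t * pmf (N t) s * pmf (p s (act s)) s')"
        by (intro suminf_sum[symmetric] summable_mult2 summ)
      also have "\<dots> = (\<Sum>t. (1 - \<alpha>) * \<alpha> ^ t * pmf (N (Suc t)) s')"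
        by (simp add: N_Suc sum_distrib_left mult_ac)
      finally have "\<alpha> * (\<Sum>s\<in>S. x s * pmf (p s (act s)) s') =
          \<alpha> * (\<Sum>t. (1 - \<alpha>) * \<alpha> ^ t * pmf (N (Suc t)) s')" by simp
      also have "\<dots> = (\<Sum>t. \<alpha> * ((1 - \<alpha>) * \<alpha> ^ t * pmf (N (Suc t)) s'))"
        by (intro suminf_mult[symmetric] summ)
      also have "\<dots> = (\<Sum>t. (1 - \<alpha>) * \<alpha> ^ Suc t * pmf (N (Suc t)) s')"
        by (simp add: mult_ac)
      also have "\<dots> = x s' - (1 - \<alpha>) * pmf \<gamma> s'"
        unfolding x_def using suminf_split_head[OF summ[of N s']] by (simp add: N_def)
      finally show ?thesis by simp
    qed
  qed
qed

lemma occ_nonempty: "occ S pr \<alpha> p \<gamma> \<noteq> {}"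
proof -
  have S: "finite S" "\<And>s. s \<in> S \<Longrightarrow> finite (A s)" "\<And>s. s \<in> S \<Longrightarrow> A s \<noteq> {}"
    and bij: "bij_betw pr UNIV (SIGMA s:S. A s)"
    using mdp by (auto simp: mdp_def)
  define act where "act = (\<lambda>s. SOME a. a \<in> A s)"
  have act: "act s \<in> A s" if "s \<in> S" for s
    using S(3)[OF that] by (simp add: act_def some_in_eq)
  obtain x where x0: "\<And>s. 0 \<le> x s"
    and x: "\<And>s'. x s' = (1 - \<alpha>) * pmf \<gamma> s' + \<alpha> * (\<Sum>s\<in>S. x s * pmf (p s (act s)) s')"
    using discounted_visits_exist[OF act] by blast
  define \<rho> :: "real^'k" where "\<rho> = (\<chi> i. case pr i of (s, a) \<Rightarrow> if a = act s then x s else 0)"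
  have "balance pr \<alpha> p s' \<rho> = (1 - \<alpha>) * pmf \<gamma> s'" if s': "s' \<in> S" for s'
  proof -
    let ?D = "\<lambda>s a. (if s' = s then 1 else 0) - \<alpha> * pmf (p s a) s'"
    have "balance pr \<alpha> p s' \<rho> =
        (\<Sum>i\<in>UNIV. case pr i of (s, a) \<Rightarrow> (if a = act s then x s else 0) * ?D s a)"
      by (simp add: balance_def \<rho>_def split_def)
    also have "\<dots> = (\<Sum>(s, a)\<in>(SIGMA s:S. A s). (if a = act s then x s else 0) * ?D s a)"
      by (rule sum.reindex_bij_betw[OF bij])
    also have "\<dots> = (\<Sum>s\<in>S. \<Sum>a\<in>A s. (if a = act s then x s else 0) * ?D s a)"
      using S by (subst sum.Sigma) auto
    also have "\<dots> = (\<Sum>s\<in>S. x s * ?D s (act s))"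
    proof (intro sum.cong refl)
      fix s assume s: "s \<in> S"
      have "(\<Sum>a\<in>A s. (if a = act s then x s else 0) * ?D s a) =
          (\<Sum>a\<in>A s. if a = act s then x s * ?D s (act s) else 0)"
        by (intro sum.cong) auto
      thus "(\<Sum>a\<in>A s. (if a = act s then x s else 0) * ?D s a) = x s * ?D s (act s)"
        using S(2)[OF s] act[OF s] by simp
    qed
    also have "\<dots> = (\<Sum>s\<in>S. (if s' = s then x s else 0) - \<alpha> * (x s * pmf (p s (act s)) s'))"
      by (intro sum.cong) (auto simp: algebra_simps)
    also have "\<dots> = x s' - \<alpha> * (\<Sum>s\<in>S. x s * pmf (p s (act s)) s')"
      using S(1) s' by (simp add: sum_subtractf sum_distrib_left)
    finally show ?thesis using x[of s'] by simp
  qed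
  moreover have "0 \<le> \<rho> $ i" for i using x0 by (auto simp: \<rho>_def split: prod.split)
  ultimately show ?thesis by (auto simp: occ_def)
qed

text \<open>
  Summation of the balance equations over all states: transition probabilities sum to 1, so each
  \<open>\<rho>\<^sub>i\<close> has total coefficient \<open>1 - \<alpha>\<close>.
\<close>

lemma occ_sum_eq_1:
  assumes \<rho>: "\<rho> \<in> occ S pr \<alpha> p \<gamma>"
  shows "(\<Sum>i\<in>UNIV. \<rho> $ i) = 1"
proof -
  have S: "finite S" "\<And>s a. s \<in> S \<Longrightarrow> a \<in> A s \<Longrightarrow> set_pmf (p s a) \<subseteq> S" "set_pmf \<gamma> \<subseteq> S"
    and bij: "bij_betw pr UNIV (SIGMA s:S. A s)"
    using mdp by (auto simp: mdp_def)
  have "(\<Sum>s'\<in>S. balance pr \<alpha> p s' \<rho>) = (\<Sum>i\<in>UNIV. (1 - \<alpha>) * \<rho> $ i)"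
    unfolding balance_def
  proof (subst sum.swap, intro sum.cong refl)
    fix i
    obtain s a where sa: "pr i = (s, a)" by fastforce
    have "pr i \<in> (SIGMA s:S. A s)" using bij by (auto simp: bij_betw_def)
    hence s: "s \<in> S" "a \<in> A s" by (simp_all add: sa)
    have "(\<Sum>s'\<in>S. \<rho> $ i * ((if s' = s then 1 else 0) - \<alpha> * pmf (p s a) s')) =
        \<rho> $ i * ((\<Sum>s'\<in>S. if s' = s then 1 else 0) - \<alpha> * (\<Sum>s'\<in>S. pmf (p s a) s'))"
      by (simp add: sum_distrib_left[symmetric] sum_subtractf)
    also have "\<dots> = (1 - \<alpha>) * \<rho> $ i"
      using S s by (simp add: sum_pmf_eq_1)
    finally show "(\<Sum>s'\<in>S. case pr i of (s, a) \<Rightarrow>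
        \<rho> $ i * ((if s' = s then 1 else 0) - \<alpha> * pmf (p s a) s')) = (1 - \<alpha>) * \<rho> $ i"
      by (simp add: sa)
  qed
  moreover have "(\<Sum>s'\<in>S. balance pr \<alpha> p s' \<rho>) = (1 - \<alpha>)"
    using \<rho> S by (simp add: occ_def sum_distrib_left[symmetric] sum_pmf_eq_1)
  ultimately show ?thesis using \<alpha> by (simp add: sum_distrib_left[symmetric])
qed

text \<open>
  Boundedness matters here: a supremum of reals is an upper bound only for sets that are bounded
  above.
\<close>

lemma sum_le_max_over_occ:
  assumes v: "\<And>i. 0 \<le> v $ i" and \<rho>: "\<rho> \<in> occ S pr \<alpha> p \<gamma>"
  shows "(\<Sum>i\<in>UNIV. \<rho> $ i * v $ i) \<le> max_over (occ S pr \<alpha> p \<gamma>) v"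
  unfolding max_over_def
proof (rule cSUP_upper[OF \<rho>])
  show "bdd_above ((\<lambda>\<rho>. \<Sum>i\<in>UNIV. \<rho> $ i * v $ i) ` occ S pr \<alpha> p \<gamma>)"
  proof (rule bdd_aboveI2)
    fix \<rho> assume \<rho>: "\<rho> \<in> occ S pr \<alpha> p \<gamma>"
    hence nn: "0 \<le> \<rho> $ i" for i by (simp add: occ_def)
    have "\<rho> $ i \<le> 1" for i
      using member_le_sum[of i UNIV "\<lambda>i. \<rho> $ i"] nn occ_sum_eq_1[OF \<rho>] by simp
    thus "(\<Sum>i\<in>UNIV. \<rho> $ i * v $ i) \<le> (\<Sum>i\<in>UNIV. v $ i)"
      using v nn by (intro sum_mono) (auto intro: mult_left_le_one_le)
  qed
qed

text \<open>
  This rests on the existence of an occupation measure, as the supremum of the empty set is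
  unspecified.
\<close>

lemma max_over_occ_nonneg:
  assumes v: "\<And>i. 0 \<le> v $ i"
  shows "0 \<le> max_over (occ S pr \<alpha> p \<gamma>) v"
proof -
  obtain \<rho> where \<rho>: "\<rho> \<in> occ S pr \<alpha> p \<gamma>" using occ_nonempty by blast
  have "0 \<le> (\<Sum>i\<in>UNIV. \<rho> $ i * v $ i)"
    using \<rho> v by (intro sum_nonneg) (auto simp: occ_def)
  also have "\<dots> \<le> max_over (occ S pr \<alpha> p \<gamma>) v" using v \<rho> by (rule sum_le_max_over_occ)
  finally show ?thesis .
qed

end

section \<open>The upper-bound program\<close>

text \<open>
  For \<open>V = 0\<close> the risk term vanishes even where \<open>h\<close> is extended by \<open>\<infinity>\<close>, so the function is
  linear on the whole space; for \<open>V > 0\<close> its domain is given by \<open>0 < y $ k \<le> 1\<close>.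
\<close>

lemma convex_ext_coupled_constraint:
  fixes \<mu> :: "real^'k" and k :: "'m::finite"
  assumes h: "convex_on {0<..1} h" and V: "0 \<le> V"
  shows "convex_ext (\<lambda>(z::real, \<rho>, y::real^'m). ereal (\<rho> \<bullet> \<mu>) + ext01 h (y $ k) * ereal V)"
proof -
  have lin: "linear (\<lambda>x::real \<times> (real^'k) \<times> (real^'m). fst (snd x) \<bullet> \<mu>)"
      "linear (\<lambda>x::real \<times> (real^'k) \<times> (real^'m). snd (snd x) $ k)"
    by (auto intro!: linearI simp: inner_add_left)
  show ?thesis
  proof (cases "V = 0")
    case True
    have "(\<lambda>(z::real, \<rho>, y::real^'m). ereal (\<rho> \<bullet> \<mu>) + ext01 h (y $ k) * ereal V)
        = (\<lambda>x. ereal (fst (snd x) \<bullet> \<mu>))"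
      using True by (auto simp: zero_ereal_def[symmetric])
    thus ?thesis using convex_ext_ereal[OF convex_on_linear[OF lin(1)]] by simp
  next
    case False
    let ?D = "(\<lambda>x::real \<times> (real^'k) \<times> (real^'m). snd (snd x) $ k) -` {0<..1}"
    let ?f = "\<lambda>x::real \<times> (real^'k) \<times> (real^'m). fst (snd x) \<bullet> \<mu> + V * h (snd (snd x) $ k)"
    have D: "convex_on ?D (\<lambda>x. h (snd (snd x) $ k))" by (rule convex_on_compose_linear[OF lin(2) h])
    hence "convex ?D" by (simp add: convex_on_def)
    hence "convex_on ?D ?f"
      using D V convex_on_subset[OF convex_on_linear[OF lin(1)], of ?D]
      by (intro convex_on_add convex_on_cmul) auto
    moreover have "(\<lambda>(z, \<rho>, y). ereal (\<rho> \<bullet> \<mu>) + ext01 h (y $ k) * ereal V)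
        = (\<lambda>x. if x \<in> ?D then ereal (?f x) else \<infinity>)"
      using False V by (auto simp: ext01_def fun_eq_iff mult.commute)
    ultimately show ?thesis by (simp only: convex_ext_if)
  qed
qed

lemma linear_balance: "linear (balance pr \<alpha> p s')"
  unfolding balance_def split_def
  by (intro linear_compose_sum ballI linearI) (simp_all add: algebra_simps)

lemma convex_program_UB_constrs:
  fixes \<mu>c :: "real^'k" and \<mu>d :: "'m::finite \<Rightarrow> real^'k"
  assumes "finite S" and V0: "convex_on UNIV V0" and f0: "0 \<le> f0 p0"
    and f: "\<And>k. f k p1 = ext01 (h k)" "\<And>k. convex_on {0<..1} (h k)" and Vs: "\<And>k. 0 \<le> Vs k"
  shows "convex_program fst (UB_constrs S pr \<alpha> p \<gamma> \<mu>c \<mu>d \<xi> p0 p1 f0 V0 f Vs)"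
proof -
  let ?v = "\<lambda>x::real \<times> (real^'k) \<times> (real^'m). x"
  have fst: "linear (\<lambda>x. fst (?v x))" by (auto intro!: linearI)
  have rho: "linear (\<lambda>x. fst (snd (?v x)))" by (auto intro!: linearI)
  have "convex_ext (\<lambda>(z, \<rho>, y::real^'m). ereal (\<rho> \<bullet> \<mu>c + f0 p0 * V0 \<rho> - z))"
  proof -
    have "linear (\<lambda>x. fst (snd (?v x)) \<bullet> \<mu>c - fst (?v x))" by (auto intro!: linearI simp: inner_add_left algebra_simps)
    moreover have "convex_on UNIV (\<lambda>x. V0 (fst (snd (?v x))))"
      using convex_on_compose_linear[OF rho V0] by simp
    ultimately have "convex_on UNIV (\<lambda>x. (fst (snd (?v x)) \<bullet> \<mu>c - fst (?v x)) + f0 p0 * V0 (fst (snd (?v x))))"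
      by (rule convex_on_add[OF convex_on_linear convex_on_cmul[OF f0]])
    from convex_ext_ereal[OF this] show ?thesis by (simp add: split_def algebra_simps)
  qed
  moreover have "convex_ext (\<lambda>(z::real, \<rho>, y). ereal (\<rho> \<bullet> \<mu>d k) + f k p1 (y $ k) * ereal (Vs k))" for k
    unfolding f(1) using f(2)[of k] Vs[of k] by (rule convex_ext_coupled_constraint)
  moreover have "linear (\<lambda>(z::real, \<rho>::real^'k, y::real^'m). \<Sum>k\<in>UNIV. y $ k)"
    by (auto intro!: linearI simp: sum.distrib sum_distrib_left)
  moreover have "convex_ext (\<lambda>(z::real, \<rho>::real^'k, y::real^'m). ereal (- (y $ k)))" for k
    using convex_ext_ereal[OF convex_on_linear, of "\<lambda>x. - (snd (snd (?v x)) $ k)"]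
    by (simp add: split_def linear_iff)
  moreover have "convex_ext (\<lambda>(z::real, \<rho>::real^'k, y::real^'m). ereal (- (\<rho> $ i)))" for i
    using convex_ext_ereal[OF convex_on_linear, of "\<lambda>x. - (fst (snd (?v x)) $ i)"]
    by (simp add: split_def linear_iff)
  moreover have "linear (\<lambda>(z::real, \<rho>::real^'k, y::real^'m). balance pr \<alpha> p s' \<rho>)" for s'
    using linear_compose[OF rho linear_balance] by (simp add: split_def o_def)
  ultimately show ?thesis
    using \<open>finite S\<close> fst unfolding convex_program_def UB_constrs_def by auto
qed

text \<open>
  For \<open>y = 0\<close> the level is 1, where no quantile bound is available; but a finite left-hand side
  forces \<open>V = 0\<close>, so that \<open>s = 0\<close> and all levels \<open>t < 1\<close> hold with the same slack.
\<close>

lemma prob_ge_level: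
  assumes qb: "quantile_bound M X m q s" and s: "0 \<le> s" "s \<le> V" and q: "\<And>t. 0 < t \<Longrightarrow> t < 1 \<Longrightarrow> 0 \<le> q t"
    and pr: "0 < pr" "pr < 1" and y: "0 \<le> y" "y \<le> 1"
    and le: "ereal m + ext01 (\<lambda>y. q (level \<theta> pr y)) y * ereal V \<le> ereal b"
  shows "level \<theta> pr y \<le> \<P>(w in M. X w \<le> b)"
proof (cases "y = 0")
  case False
  hence yp: "0 < y" using y by simp
  hence l: "0 < level \<theta> pr y" "level \<theta> pr y < 1"
    using pr by (auto simp: level_eq_exp mult_neg_pos)
  have "m + q (level \<theta> pr y) * V \<le> b" using le yp y by (simp add: ext01_def)
  moreover have "q (level \<theta> pr y) * s \<le> q (level \<theta> pr y) * V" using q l s by (intro mult_left_mono) auto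
  ultimately have "q (level \<theta> pr y) * s \<le> b - m" by simp
  thus ?thesis using qb l unfolding quantile_bound_def by fastforce
next
  case True
  have "V = 0"
  proof (rule ccontr)
    assume "V \<noteq> 0"
    hence "0 < V" using s by simp
    thus False using le True by (simp add: ext01_def)
  qed
  hence "s = 0" "m \<le> b" using s le by (auto simp: zero_ereal_def[symmetric])
  hence "t \<le> \<P>(w in M. X w \<le> b)" if "0 < t" "t < 1" for t
    using qb that unfolding quantile_bound_def by (force dest: spec[of _ t] spec[of _ "b - m"])
  hence "1 \<le> \<P>(w in M. X w \<le> b)" by (intro dense_le_bounded[of 0 1]) auto
  thus ?thesis using True pr by (simp add: level_def)
qed

text \<open>
  The common core of the three cases. The dispersion of each constraint may depend on \<open>\<rho>\<close> in a
  nonlinear way; all that is used is its linear majorant with coefficients \<open>v k\<close> on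
  nonnegative vectors.
\<close>

lemma UB_valid_of_quantile_bounds:
  fixes c :: "'w \<Rightarrow> real^'k" and d :: "'m::finite \<Rightarrow> 'w \<Rightarrow> real^'k" and v :: "'m \<Rightarrow> real^'k"
  assumes mdp: "mdp S A pr p \<gamma>" and \<alpha>: "0 < \<alpha>" "\<alpha> < 1"
    and p: "0 < p0" "p0 < 1" "0 < p1" "p1 < 1" and \<theta>: "1 \<le> \<theta>"
    and q0: "\<And>t. 0 < t \<Longrightarrow> t < 1 \<Longrightarrow> 0 \<le> q t"
    and q: "convex_on {0<..} (\<lambda>t. q (exp (- t)))" "antimono_on {0<..} (\<lambda>t. q (exp (- t)))"
    and f: "\<And>k. f k p1 = ext01 (\<lambda>y. q (level \<theta> p1 y))"
    and V0: "convex_on UNIV V0"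
    and qc: "\<And>\<rho>. quantile_bound M (\<lambda>w. \<rho> \<bullet> c w) (\<rho> \<bullet> mean_vec M c) q (V0 \<rho>)"
    and qd: "\<And>k \<rho>. quantile_bound M (\<lambda>w. \<rho> \<bullet> d k w) (\<rho> \<bullet> mean_vec M (d k)) q (sd k \<rho>)"
    and sd: "\<And>k \<rho>. 0 \<le> sd k \<rho>" 
      "\<And>k \<rho>. (\<And>i. 0 \<le> \<rho> $ i) \<Longrightarrow> sd k \<rho> \<le> (\<Sum>i\<in>UNIV. \<rho> $ i * v k $ i)"
    and v: "\<And>k i. 0 \<le> v k $ i"
  shows "UB_valid M c d S pr \<alpha> p \<gamma> \<xi> p0 p1 \<theta> q V0 f (\<lambda>k. max_over (occ S pr \<alpha> p \<gamma>) (v k))"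
  unfolding UB_valid_def Let_def
proof
  let ?Vs = "\<lambda>k. max_over (occ S pr \<alpha> p \<gamma>) (v k)"
  let ?UB = "UB_constrs S pr \<alpha> p \<gamma> (mean_vec M c) (\<lambda>k. mean_vec M (d k)) \<xi> p0 p1 q V0 f ?Vs"
  have "finite S" using mdp by (simp add: mdp_def)
  thus "convex_program fst ?UB"
    using V0 q0[OF p(1,2)] f convex_on_quantile_level[OF p(3,4) \<theta> q] max_over_occ_nonneg[OF mdp \<alpha> v]
    by (rule convex_program_UB_constrs)
  have "feasible ?UB \<subseteq> ICCP_feasible M c d \<xi> p0 p1 \<theta> (occ S pr \<alpha> p \<gamma>)"
    unfolding feasible_UB_constrs ICCP_feasible_def
  proof clarsimp
    fix z \<rho> and y :: "real^'m"
    assume z: "\<rho> \<bullet> mean_vec M c + q p0 * V0 \<rho> \<le> z"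
      and d: "\<forall>k. ereal (\<rho> \<bullet> mean_vec M (d k)) + f k p1 (y $ k) * ereal (?Vs k) \<le> ereal (\<xi> k)"
      and y: "(\<Sum>k\<in>UNIV. y $ k) = 1" "\<forall>k. 0 \<le> y $ k" and \<rho>: "\<rho> \<in> occ S pr \<alpha> p \<gamma>"
    have "q p0 * V0 \<rho> \<le> z - \<rho> \<bullet> mean_vec M c" using z by simp
    hence "p0 \<le> \<P>(w in M. \<rho> \<bullet> c w \<le> z)"
      using qc[of \<rho>] p unfolding quantile_bound_def by fastforce
    moreover have "level \<theta> p1 (y $ k) \<le> \<P>(w in M. \<rho> \<bullet> d k w \<le> \<xi> k)" for k
    proof (rule prob_ge_level[OF qd sd(1) _ q0 p(3,4)])
      have "sd k \<rho> \<le> (\<Sum>i\<in>UNIV. \<rho> $ i * v k $ i)" using \<rho> by (intro sd) (simp add: occ_def)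
      also have "\<dots> \<le> ?Vs k" using v \<rho> by (rule sum_le_max_over_occ[OF mdp \<alpha>])
      finally show "sd k \<rho> \<le> ?Vs k" .
      show "y $ k \<le> 1" using member_le_sum[of k UNIV "\<lambda>k. y $ k"] y by simp
      show "ereal (\<rho> \<bullet> mean_vec M (d k)) + ext01 (\<lambda>y. q (level \<theta> p1 y)) (y $ k) * ereal (?Vs k) \<le> ereal (\<xi> k)"
        using d f by metis
    qed (use y in auto)
    ultimately show "p0 \<le> \<P>(w in M. \<rho> \<bullet> c w \<le> z) \<and> (\<forall>k. level \<theta> p1 (y $ k) \<le> \<P>(w in M. \<rho> \<bullet> d k w \<le> \<xi> k))"
      by blast
  qed
  thus "opt_value fst (ICCP_feasible M c d \<xi> p0 p1 \<theta> (occ S pr \<alpha> p \<gamma>)) \<le> opt_value fst (feasible ?UB)"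
    unfolding opt_value_def by (rule INF_superset_mono) simp
qed

theorem theorem5:
  fixes M :: "'w measure"
    and c :: "'w \<Rightarrow> real^'k" and d :: "'m::finite \<Rightarrow> 'w \<Rightarrow> real^'k"
    and S :: "'s set" and A :: "'s \<Rightarrow> 'a set" and pr :: "'k::finite \<Rightarrow> 's \<times> 'a"
    and \<alpha> :: real and p :: "'s \<Rightarrow> 'a \<Rightarrow> 's pmf" and \<gamma> :: "'s pmf"
    and \<xi> :: "'m \<Rightarrow> real" and p0 p1 \<theta> :: real
    and cl cu \<sigma>c :: "real^'k" and dl du \<sigma>d :: "'m \<Rightarrow> real^'k"
  assumes "mdp S A pr p \<gamma>"
    and "0 < \<alpha>" "\<alpha> < 1" "0 < p0" "p0 < 1" "0 < p1" "p1 < 1" "1 \<le> \<theta>"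
    and "prob_space M" "c \<in> borel_measurable M" "\<And>k. d k \<in> borel_measurable M"
  shows
    "(has_mean_cov M c \<and> (\<forall>k. has_mean_cov M (d k)) \<longrightarrow>
        UB_valid M c d S pr \<alpha> p \<gamma> \<xi> p0 p1 \<theta>
          (\<lambda>q. sqrt (q / (1 - q)))
          (\<lambda>\<rho>. norm (psd_sqrt (cov_mat M c) *v \<rho>))
          (\<lambda>k. f_cov \<theta>)
          (\<lambda>k. max_over (occ S pr \<alpha> p \<gamma>) (\<chi> i. norm (column i (psd_sqrt (cov_mat M (d k)))))))
     \<and>
     (bounded_by M c cl cu \<and> (\<forall>k. bounded_by M (d k) (dl k) (du k)) \<and>
      indep_components M c \<and> (\<forall>k. indep_components M (d k)) \<and>
      1 - exp (- (1/2)) \<le> p1 \<longrightarrow>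
        UB_valid M c d S pr \<alpha> p \<gamma> \<xi> p0 p1 \<theta>
          (\<lambda>q. sqrt (- (1/2) * ln (1 - q)))
          (\<lambda>\<rho>. norm (psd_sqrt (diag_mat (\<chi> i. (cu $ i - cl $ i)\<^sup>2)) *v \<rho>))
          (\<lambda>k. f_hoeffding \<theta>)
          (\<lambda>k. max_over (occ S pr \<alpha> p \<gamma>) (du k - dl k)))
     \<and>
     (indep_components M c \<and> (\<forall>k. indep_components M (d k)) \<and>
      (\<forall>i. sub_gaussian M (\<lambda>w. c w $ i) (\<sigma>c $ i)) \<and>
      (\<forall>k i. sub_gaussian M (\<lambda>w. d k w $ i) (\<sigma>d k $ i)) \<and>
      1 - exp (- (1/2)) \<le> p1 \<longrightarrow>
        UB_valid M c d S pr \<alpha> p \<gamma> \<xi> p0 p1 \<theta>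
          (\<lambda>q. sqrt (- 2 * ln (1 - q)))
          (\<lambda>\<rho>. norm (psd_sqrt (diag_mat (\<chi> i. (\<sigma>c $ i)\<^sup>2)) *v \<rho>))
          (\<lambda>k. f_sub_gaussian \<theta>)
          (\<lambda>k. max_over (occ S pr \<alpha> p \<gamma>) (\<sigma>d k)))"
proof -
  let ?Q = "occ S pr \<alpha> p \<gamma>"
  note UB = UB_valid_of_quantile_bounds[OF assms(1-8)]
  have L2_nonneg_le: "L2_set (\<lambda>i. \<rho> $ i * v $ i) UNIV \<le> (\<Sum>i\<in>UNIV. \<rho> $ i * v $ i)"
    if "\<And>i. 0 \<le> \<rho> $ i" "\<And>i. 0 \<le> v $ i" for \<rho> v :: "real^'k"
    using that by (intro L2_set_le_sum) auto
  have V0: "convex_on UNIV (\<lambda>\<rho>. norm (R *v \<rho>))" for R :: "real^'k^'k"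
    by (rule convex_on_norm_linear) simp
  show ?thesis
  proof (intro conjI impI; (elim conjE)?)
    assume c: "has_mean_cov M c" and d: "\<forall>k. has_mean_cov M (d k)"
    show "UB_valid M c d S pr \<alpha> p \<gamma> \<xi> p0 p1 \<theta>
          (\<lambda>q. sqrt (q / (1 - q)))
          (\<lambda>\<rho>. norm (psd_sqrt (cov_mat M c) *v \<rho>))
          (\<lambda>k. f_cov \<theta>)
          (\<lambda>k. max_over ?Q (\<chi> i. norm (column i (psd_sqrt (cov_mat M (d k))))))"
    proof (rule UB[where sd = "\<lambda>k \<rho>. norm (psd_sqrt (cov_mat M (d k)) *v \<rho>)"])
      show "norm (psd_sqrt (cov_mat M (d k)) *v \<rho>) \<le>
          (\<Sum>i\<in>UNIV. \<rho> $ i * (\<chi> i. norm (column i (psd_sqrt (cov_mat M (d k))))) $ i)"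
        if "\<And>i. 0 \<le> \<rho> $ i" for k \<rho>
        using norm_matrix_vector_mult_le_columns[OF that] by simp
    qed (use c d assms in \<open>auto intro!: inner_moment_quantile_bound V0 convex_antimono_odds simp: f_cov_def\<close>)
  next
    assume c: "bounded_by M c cl cu" and d: "\<forall>k. bounded_by M (d k) (dl k) (du k)"
      and ind: "indep_components M c" "\<forall>k. indep_components M (d k)"
    obtain w where "w \<in> space M" using prob_space.not_empty[OF assms(9)] by blast
    hence du: "0 \<le> (du k - dl k) $ i" for k i using d by (force simp: bounded_by_def intro: order_trans)
    show "UB_valid M c d S pr \<alpha> p \<gamma> \<xi> p0 p1 \<theta>
          (\<lambda>q. sqrt (- (1/2) * ln (1 - q)))
          (\<lambda>\<rho>. norm (psd_sqrt (diag_mat (\<chi> i. (cu $ i - cl $ i)\<^sup>2)) *v \<rho>))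
          (\<lambda>k. f_hoeffding \<theta>)
          (\<lambda>k. max_over ?Q (du k - dl k))"
    proof (rule UB[where sd = "\<lambda>k \<rho>. L2_set (\<lambda>i. \<rho> $ i * (du k - dl k) $ i) UNIV"])
      show "quantile_bound M (\<lambda>w. \<rho> \<bullet> c w) (\<rho> \<bullet> mean_vec M c) (\<lambda>q. sqrt (- (1/2) * ln (1 - q)))
          (norm (psd_sqrt (diag_mat (\<chi> i. (cu $ i - cl $ i)\<^sup>2)) *v \<rho>))" for \<rho>
        using inner_bounded_quantile_bound[OF assms(9,10) ind(1) c] norm_psd_sqrt_diag_mat[of "cu - cl"] by simp
      show "quantile_bound M (\<lambda>w. \<rho> \<bullet> d k w) (\<rho> \<bullet> mean_vec M (d k)) (\<lambda>q. sqrt (- (1/2) * ln (1 - q)))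
          (L2_set (\<lambda>i. \<rho> $ i * (du k - dl k) $ i) UNIV)" for k \<rho>
        using ind(2) d by (intro inner_bounded_quantile_bound[OF assms(9,11)]) auto
      show "L2_set (\<lambda>i. \<rho> $ i * (du k - dl k) $ i) UNIV \<le> (\<Sum>i\<in>UNIV. \<rho> $ i * (du k - dl k) $ i)"
        if "\<And>i. 0 \<le> \<rho> $ i" for k \<rho> using that du by (rule L2_nonneg_le)
    qed (use convex_antimono_sqrt_log[of "1/2"] V0 in \<open>auto simp: f_hoeffding_def du[simplified]\<close>)
  next
    assume ind: "indep_components M c" "\<forall>k. indep_components M (d k)"
      and c: "\<forall>i. sub_gaussian M (\<lambda>w. c w $ i) (\<sigma>c $ i)"
      and d: "\<forall>k i. sub_gaussian M (\<lambda>w. d k w $ i) (\<sigma>d k $ i)"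
    have \<sigma>d: "0 \<le> \<sigma>d k $ i" for k i using d by (simp add: sub_gaussian_def)
    show "UB_valid M c d S pr \<alpha> p \<gamma> \<xi> p0 p1 \<theta>
          (\<lambda>q. sqrt (- 2 * ln (1 - q)))
          (\<lambda>\<rho>. norm (psd_sqrt (diag_mat (\<chi> i. (\<sigma>c $ i)\<^sup>2)) *v \<rho>))
          (\<lambda>k. f_sub_gaussian \<theta>)
          (\<lambda>k. max_over ?Q (\<sigma>d k))"
    proof (rule UB[where sd = "\<lambda>k \<rho>. L2_set (\<lambda>i. \<rho> $ i * \<sigma>d k $ i) UNIV"])
      show "quantile_bound M (\<lambda>w. \<rho> \<bullet> c w) (\<rho> \<bullet> mean_vec M c) (\<lambda>q. sqrt (- 2 * ln (1 - q)))
          (norm (psd_sqrt (diag_mat (\<chi> i. (\<sigma>c $ i)\<^sup>2)) *v \<rho>))" for \<rho>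
        unfolding norm_psd_sqrt_diag_mat
        using c by (intro inner_sub_gaussian_quantile_bound[OF assms(9) ind(1)]) auto
      show "quantile_bound M (\<lambda>w. \<rho> \<bullet> d k w) (\<rho> \<bullet> mean_vec M (d k)) (\<lambda>q. sqrt (- 2 * ln (1 - q)))
          (L2_set (\<lambda>i. \<rho> $ i * \<sigma>d k $ i) UNIV)" for k \<rho>
        using ind(2) d by (intro inner_sub_gaussian_quantile_bound[OF assms(9)]) auto
      show "L2_set (\<lambda>i. \<rho> $ i * \<sigma>d k $ i) UNIV \<le> (\<Sum>i\<in>UNIV. \<rho> $ i * \<sigma>d k $ i)"
        if "\<And>i. 0 \<le> \<rho> $ i" for k \<rho> using that \<sigma>d by (rule L2_nonneg_le)
    qed (use convex_antimono_sqrt_log[of 2] V0 in \<open>auto simp: f_sub_gaussian_def \<sigma>d\<close>)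
  qed
qed

end
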